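(* For any realization $x_1,\dots,x_n$ of $X_1,\dots,X_n$, any integer $m\ge1$, any $0<a<1$ and any $0\le\varepsilon\le1$, $$\mathbb P\Big(\frac1{1+a}\hat L_m(\hat g_1^n)-\mathbb L(\hat g_1^n)>\varepsilon\Big)\le\Big(1+2\exp\Big(\frac{\ln2}{t_{mix}}\Big)\Big)\exp\Bigg(-\frac{a(1+a)m\varepsilon}{4t_{mix}\big(8(1+\frac1{\gamma_{ps}})+20\big)}\Bigg),$$ and $$\mathbb P\Big(\mathbb L(\hat g_1^n)-\frac1{1-a}\hat L_m(\hat g_1^n)>\varepsilon\Big)\le\Big(1+2\exp\Big(\frac{\ln2}{t_{mix}}\Big)\Big)\exp\Bigg(-\frac{a(1-a)m\varepsilon}{4t_{mix}\big(8(1+\frac1{\gamma_{ps}})+20\big)}\Bigg).$$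
   Context: Process. Let $\mathcal Y$ be a Polish space and $(Y_t)_{t\in\mathbb Z}$ a $\mathcal Y$-valued Markov chain of order $k_0$ that is time homogeneous, stationary and uniformly ergodic. Fix an integer $p\ge k_0$ and put $X_t=(Y_t,Y_{t-1},\dots,Y_{t-p})^T$, with values in $\mathcal X=\mathcal Y^{p+1}$. Then $(X_t)_{t\in\mathbb Z}$ is a time homogeneous, stationary, uniformly ergodic Markov chain of order $1$; $K$ denotes its transition kernel and $Q$ its stationary law. With $d_{TV}(P,P')=\sup_A|P(A)-P'(A)|$, uniform ergodicity means that there are $C>0$ and $0<\rho<1$ with $\sup_{x\in\mathcal X}d_{TV}(K^n(x,\cdot),Q)\le C\rho^n$ for all $n$. The mixing time is $t_{mix}=\min\{t\ge 1:\ \sup_{x\in\mathcal X}d_{TV}(K^t(x,\cdot),Q)\le 1/4\}$. Pseudo spectral gap. View Markov kernels with invariant law $Q$ as bounded operators on $L^2(Q)$; $K^*$ is the adjoint of $K$ on $L^2(Q)$ (the time reversal of $K$). For a self-adjoint Markov operator $M$ on $L^2(Q)$ let $S_2(M)=\{\lambda\in\mathbb C\setminus\{0\}: (\lambda I-M)^{-1}$ does not exist as a bounded linear operator on $L^2(Q)\}$; its spectral gap is $\gamma(M)=1-\sup\{\lambda\in S_2(M):\lambda\ne1\}$ (with $\sup\emptyset=0$) if the eigenvalue $1$ has multiplicity one, and $\gamma(M)=0$ otherwise. The pseudo spectral gap is $\gamma_{ps}=\max_{k\ge1}\gamma((K^* )^kK^k)/k$. Losses. A prediction function is a measurable $g:\mathcal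 Y^p\to\mathcal Y$; $\mathcal F$ is the set of all of them. A loss function is a measurable $L:\mathcal Y^2\to[0,1]$; write $L(g(X_t)):=L(g(Y_{t-1},\dots,Y_{t-p}),Y_t)$. The expected loss is $\mathbb L(g)=\mathbb E_Q(L(g(X)))$ with $X\sim Q$. The out-of-sample empirical loss on the validation set $(X_{n+1},\dots,X_{n+m})$ is $\hat L_m(g)=\frac1m\sum_{j=n+1}^{n+m}L(g(X_j))$. Estimator. Let $\tilde L$ be a loss function (possibly different from $L$) and $\mathcal G\subset\mathcal F$. For a realization $x_1,\dots,x_n$ of the learning set, $\hat g_1^n\in\arg\min_{g\in\mathcal G}\sum_{t=1}^n\tilde L(g(x_t))$. $\mathbb P$ is taken conditionally on $X_1=x_1,\dots,X_n=x_n$; thus $\hat g_1^n$ is a fixed function, and $(X_{n+j})_{j\ge1}$ is the chain with kernel $K$ started from $X_n=x_n$. *)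

theory Defs
  imports "HOL-Probability.Probability"
begin

section \<open>Markov kernels\<close>

definition tv_dist :: "'a measure \<Rightarrow> 'a measure \<Rightarrow> real" where
  "tv_dist P P' = (SUP A\<in>sets P. \<bar>measure P A - measure P' A\<bar>)"

definition kernel_pow :: "'a measure \<Rightarrow> ('a \<Rightarrow> 'a measure) \<Rightarrow> nat \<Rightarrow> 'a \<Rightarrow> 'a measure" where
  "kernel_pow S K t x = ((\<lambda>\<mu>. \<mu> \<bind> K) ^^ t) (return S x)"

definition uniformly_ergodic :: "'a measure \<Rightarrow> ('a \<Rightarrow> 'a measure) \<Rightarrow> 'a measure \<Rightarrow> bool" where
  "uniformly_ergodic S K Q \<longleftrightarrow>
     (\<exists>C \<rho>. 0 < C \<and> 0 < \<rho> \<and> \<rho> < 1 \<and>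
        (\<forall>t. (SUP x\<in>space S. tv_dist (kernel_pow S K t x) Q) \<le> C * \<rho> ^ t))"

definition mixing_time :: "'a measure \<Rightarrow> ('a \<Rightarrow> 'a measure) \<Rightarrow> 'a measure \<Rightarrow> nat" where
  "mixing_time S K Q =
     (LEAST t. 1 \<le> t \<and> (SUP x\<in>space S. tv_dist (kernel_pow S K t x) Q) \<le> 1 / 4)"


section \<open>Operators on complex \<open>L\<^sup>2(Q)\<close>\<close>

text \<open>
  Elements of \<open>L\<^sup>2(Q)\<close> are represented by functions, and every identity between them is
  understood \<open>Q\<close>-almost everywhere. An operator is a map on representatives that is
  compatible with almost-everywhere equality.
\<close>

definition L2_space :: "'a measure \<Rightarrow> ('a \<Rightarrow> complex) set" where
  "L2_space Q = {f \<in> borel_measurable Q. integrable Q (\<lambda>x. (cmod (f x))\<^sup>2)}"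

definition L2_norm :: "'a measure \<Rightarrow> ('a \<Rightarrow> complex) \<Rightarrow> real" where
  "L2_norm Q f = sqrt (\<integral>x. (cmod (f x))\<^sup>2 \<partial>Q)"

definition L2_inner :: "'a measure \<Rightarrow> ('a \<Rightarrow> complex) \<Rightarrow> ('a \<Rightarrow> complex) \<Rightarrow> complex" where
  "L2_inner Q f g = (\<integral>x. f x * cnj (g x) \<partial>Q)"

definition L2_bounded_operator ::
  "'a measure \<Rightarrow> (('a \<Rightarrow> complex) \<Rightarrow> ('a \<Rightarrow> complex)) \<Rightarrow> bool" where
  "L2_bounded_operator Q T \<longleftrightarrow>
     (\<forall>f\<in>L2_space Q. T f \<in> L2_space Q) \<and>
     (\<forall>f\<in>L2_space Q. \<forall>g\<in>L2_space Q.
        (AE x in Q. f x = g x) \<longrightarrow> (AE x in Q. T f x = T g x)) \<and>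
     (\<forall>f\<in>L2_space Q. \<forall>g\<in>L2_space Q. AE x in Q. T (\<lambda>z. f z + g z) x = T f x + T g x) \<and>
     (\<forall>c. \<forall>f\<in>L2_space Q. AE x in Q. T (\<lambda>z. c * f z) x = c * T f x) \<and>
     (\<exists>B. \<forall>f\<in>L2_space Q. L2_norm Q (T f) \<le> B * L2_norm Q f)"

text \<open>The adjoint is unique up to \<open>Q\<close>-null sets, which no notion below can see.\<close>

definition L2_adjoint ::
  "'a measure \<Rightarrow> (('a \<Rightarrow> complex) \<Rightarrow> ('a \<Rightarrow> complex)) \<Rightarrow> (('a \<Rightarrow> complex) \<Rightarrow> ('a \<Rightarrow> complex))"
where
  "L2_adjoint Q T = (SOME T'. L2_bounded_operator Q T' \<and>
     (\<forall>f\<in>L2_space Q. \<forall>g\<in>L2_space Q. L2_inner Q (T f) g = L2_inner Q f (T' g)))"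

definition kernel_operator :: "('a \<Rightarrow> 'a measure) \<Rightarrow> ('a \<Rightarrow> complex) \<Rightarrow> ('a \<Rightarrow> complex)" where
  "kernel_operator K f = (\<lambda>x. \<integral>z. f z \<partial>K x)"

definition S2 :: "'a measure \<Rightarrow> (('a \<Rightarrow> complex) \<Rightarrow> ('a \<Rightarrow> complex)) \<Rightarrow> complex set" where
  "S2 Q T = {l. l \<noteq> 0 \<and>
     \<not> (\<exists>R. L2_bounded_operator Q R \<and>
           (\<forall>f\<in>L2_space Q.
              (AE x in Q. R (\<lambda>z. l * f z - T f z) x = f x) \<and>
              (AE x in Q. l * R f x - T (R f) x = f x)))}"

definition eigenvalue_1_simple ::
  "'a measure \<Rightarrow> (('a \<Rightarrow> complex) \<Rightarrow> ('a \<Rightarrow> complex)) \<Rightarrow> bool" where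
  "eigenvalue_1_simple Q T \<longleftrightarrow>
     (\<exists>e\<in>L2_space Q. (AE x in Q. T e x = e x) \<and> \<not> (AE x in Q. e x = 0) \<and>
        (\<forall>f\<in>L2_space Q. (AE x in Q. T f x = f x) \<longrightarrow> (\<exists>c. AE x in Q. f x = c * e x)))"

text \<open>
  Meant for self-adjoint \<open>T\<close>, whose spectrum is real; hence the supremum over real numbers.
\<close>

definition spectral_gap ::
  "'a measure \<Rightarrow> (('a \<Rightarrow> complex) \<Rightarrow> ('a \<Rightarrow> complex)) \<Rightarrow> real" where
  "spectral_gap Q T =
     (if eigenvalue_1_simple Q T
      then 1 - (let R = {r::real. complex_of_real r \<in> S2 Q T \<and> r \<noteq> 1}
                in if R = {} then 0 else Sup R)
      else 0)"

text \<open>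
  For a Markov kernel with invariant law \<open>Q\<close> these gaps lie in \<open>[0,1]\<close>, so the terms tend to \<open>0\<close> and
  the supremum is attained: it is the maximum.
\<close>

definition pseudo_spectral_gap :: "'a measure \<Rightarrow> ('a \<Rightarrow> 'a measure) \<Rightarrow> real" where
  "pseudo_spectral_gap Q K =
     (SUP k\<in>{1::nat..}.
        spectral_gap Q ((L2_adjoint Q (kernel_operator K) ^^ k) \<circ> (kernel_operator K ^^ k)) / real k)"


section \<open>The process \<open>Y\<close> and the block process \<open>X\<close>\<close>

text \<open>
  \<open>P h\<close> is the law of the next value given the last \<open>k\<close> values, most recent first:
  \<open>h i\<close> is the value observed \<open>i + 1\<close> steps earlier. Time homogeneity is the independence
  of \<open>P\<close> from \<open>t\<close>.
\<close>

definition markov_chain_of_order ::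
  "'w measure \<Rightarrow> nat \<Rightarrow> ((nat \<Rightarrow> 'y) \<Rightarrow> 'y measure) \<Rightarrow> (int \<Rightarrow> 'w \<Rightarrow> 'y::topological_space) \<Rightarrow> bool"
where
  "markov_chain_of_order M k P Y \<longleftrightarrow>
     (\<forall>t. Y t \<in> borel_measurable M) \<and>
     P \<in> (\<Pi>\<^sub>M i\<in>{..<k}. borel) \<rightarrow>\<^sub>M prob_algebra borel \<and>
     (\<forall>t. \<forall>A\<in>sets borel. AE \<omega> in M.
        real_cond_exp M
          (vimage_algebra (space M) (\<lambda>\<omega>. \<lambda>s\<in>{..<t}. Y s \<omega>) (\<Pi>\<^sub>M s\<in>{..<t}. borel))
          (indicator (Y t -` A \<inter> space M)) \<omega>
        = measure (P (\<lambda>i\<in>{..<k}. Y (t - 1 - int i) \<omega>)) A)"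

definition stationary :: "'w measure \<Rightarrow> (int \<Rightarrow> 'w \<Rightarrow> 'y::topological_space) \<Rightarrow> bool" where
  "stationary M Y \<longleftrightarrow>
     (\<forall>s. distr M (\<Pi>\<^sub>M t\<in>UNIV. borel) (\<lambda>\<omega> t. Y (t + s) \<omega>) =
          distr M (\<Pi>\<^sub>M t\<in>UNIV. borel) (\<lambda>\<omega> t. Y t \<omega>))"

text \<open>
  \<open>\<Y>\<^sup>p\<^sup>+\<^sup>1\<close> is the product over the index set \<open>{..p}\<close>, and
  \<open>block p y t\<close> is \<open>(y\<^sub>t, y\<^sub>t\<^sub>-\<^sub>1, \<dots>, y\<^sub>t\<^sub>-\<^sub>p)\<close>.
\<close>

abbreviation block_space :: "nat \<Rightarrow> (nat \<Rightarrow> 'y::topological_space) measure" where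
  "block_space p \<equiv> (\<Pi>\<^sub>M i\<in>{..p}. borel)"

definition block :: "nat \<Rightarrow> (int \<Rightarrow> 'y) \<Rightarrow> int \<Rightarrow> (nat \<Rightarrow> 'y)" where
  "block p y t = (\<lambda>i\<in>{..p}. y (t - int i))"

text \<open>For \<open>k \<le> p\<close>: draw the new value from \<open>P\<close>, shift the others and drop the oldest one.\<close>

definition block_kernel ::
  "nat \<Rightarrow> nat \<Rightarrow> ((nat \<Rightarrow> 'y) \<Rightarrow> 'y::topological_space measure) \<Rightarrow> (nat \<Rightarrow> 'y) \<Rightarrow> (nat \<Rightarrow> 'y) measure"
where
  "block_kernel k p P x =
     distr (P (\<lambda>i\<in>{..<k}. x i)) (block_space p) (\<lambda>u. \<lambda>i\<in>{..p}. if i = 0 then u else x (i - 1))"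

text \<open>
  The conditional law of \<open>(X\<^sub>1, \<dots>, X\<^sub>n\<^sub>+\<^sub>m)\<close> given \<open>X\<^sub>1 = x\<^sub>1, \<dots>, X\<^sub>n = x\<^sub>n\<close>, for a chain with
  kernel \<open>K\<close> and \<open>n \<ge> 1\<close>. It is the version of the regular conditional law that makes
  \<open>(X\<^sub>n\<^sub>+\<^sub>j)\<close> the chain with kernel \<open>K\<close> started from \<open>X\<^sub>n = x\<^sub>n\<close>, so it is defined for
  every \<open>x\<close> and not only for almost every one.
\<close>

primrec conditional_law ::
  "'x measure \<Rightarrow> ('x \<Rightarrow> 'x measure) \<Rightarrow> nat \<Rightarrow> (nat \<Rightarrow> 'x) \<Rightarrow> nat \<Rightarrow> (nat \<Rightarrow> 'x) measure" where
  "conditional_law S K n x 0 = return (\<Pi>\<^sub>M t\<in>{1..n}. S) (\<lambda>t\<in>{1..n}. x t)"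
| "conditional_law S K n x (Suc m) =
     conditional_law S K n x m \<bind>
       (\<lambda>z. distr (K (z (n + m))) (\<Pi>\<^sub>M t\<in>{1..n + Suc m}. S) (\<lambda>u. z(n + Suc m := u)))"


section \<open>Prediction functions and losses\<close>

definition prediction_functions :: "nat \<Rightarrow> ((nat \<Rightarrow> 'y::topological_space) \<Rightarrow> 'y) set" where
  "prediction_functions p = (\<Pi>\<^sub>M i\<in>{..<p}. borel) \<rightarrow>\<^sub>M borel"

definition loss_function :: "('y::topological_space \<Rightarrow> 'y \<Rightarrow> real) \<Rightarrow> bool" where
  "loss_function L \<longleftrightarrow>
     case_prod L \<in> borel_measurable (borel \<Otimes>\<^sub>M borel) \<and> (\<forall>u v. 0 \<le> L u v \<and> L u v \<le> 1)"

definition prediction_loss ::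
  "nat \<Rightarrow> ('y \<Rightarrow> 'y \<Rightarrow> real) \<Rightarrow> ((nat \<Rightarrow> 'y) \<Rightarrow> 'y) \<Rightarrow> (nat \<Rightarrow> 'y) \<Rightarrow> real" where
  "prediction_loss p L g x = L (g (\<lambda>i\<in>{..<p}. x (i + 1))) (x 0)"

definition expected_loss ::
  "nat \<Rightarrow> ('y \<Rightarrow> 'y \<Rightarrow> real) \<Rightarrow> (nat \<Rightarrow> 'y) measure \<Rightarrow> ((nat \<Rightarrow> 'y) \<Rightarrow> 'y) \<Rightarrow> real" where
  "expected_loss p L Q g = (\<integral>x. prediction_loss p L g x \<partial>Q)"

definition validation_loss ::
  "nat \<Rightarrow> ('y \<Rightarrow> 'y \<Rightarrow> real) \<Rightarrow> nat \<Rightarrow> nat \<Rightarrow> ((nat \<Rightarrow> 'y) \<Rightarrow> 'y) \<Rightarrow> (nat \<Rightarrow> nat \<Rightarrow> 'y) \<Rightarrow> real" where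
  "validation_loss p L n m g z = (1 / real m) * (\<Sum>j=n+1..n+m. prediction_loss p L g (z j))"

end

theory Submission
  imports Defs
begin

text \<open>
  The concentration needs no spectral theory. Let \<open>f\<close> be the loss with mean \<open>\<mu>\<close> under \<open>Q\<close>. Mixing makes
  \<open>K\<^sup>t\<close> with \<open>t = t\<^sub>m\<^sub>i\<^sub>x\<close> halve the sup norm of centred functions, so the Poisson equation
  \<open>h - K h = f - \<mu>\<close> has a solution with \<open>\<bar>h\<bar> \<le> 2 t\<^sub>m\<^sub>i\<^sub>x\<close>. For small \<open>\<theta>\<close> the function \<open>V = 1 + \<eta> h\<close> with \<open>\<eta>\<close>
  slightly above \<open>\<theta>\<close> satisfies \<open>K V \<le> exp ((1 + a) \<theta> \<mu> - \<theta> f) V\<close> (and \<open>V = 1 - \<eta> h\<close> a similar bound for the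
  lower tail). This gives an exponential supermartingale along the chain, and Markov's inequality
  yields the bound for every \<open>\<theta> \<le> a / (8 t\<^sub>m\<^sub>i\<^sub>x)\<close>.

  The value \<open>\<theta> = a / (4 t\<^sub>m\<^sub>i\<^sub>x (8 (1 + 1 / \<gamma>\<^sub>p\<^sub>s) + 20))\<close> is admissible as soon as \<open>\<gamma>\<^sub>p\<^sub>s \<ge> 0\<close>
  (for \<open>\<gamma>\<^sub>p\<^sub>s = 0\<close> the quotient \<open>1 / \<gamma>\<^sub>p\<^sub>s\<close> is \<open>0\<close> here). Nonnegativity holds since \<open>(K\<^sup>*)\<^sup>k K\<^sup>k\<close> is a
  contraction of \<open>L\<^sup>2(Q)\<close>: by the Neumann series its spectrum lies in the closed unit disc, so every gap
  lies in \<open>[0, 2]\<close>. Invariance of \<open>Q\<close> under \<open>K\<close> is a consequence of uniform ergodicity.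
\<close>

section \<open>The space \<open>L\<^sup>2\<close>\<close>

lemma L2_space_iff:
  "f \<in> L2_space Q \<longleftrightarrow> f \<in> borel_measurable Q \<and> (\<integral>\<^sup>+x. ennreal ((cmod (f x))\<^sup>2) \<partial>Q) < \<infinity>"
  by (auto simp: L2_space_def integrable_iff_bounded)

lemma L2_space_measurable[measurable_dest]: "f \<in> L2_space Q \<Longrightarrow> f \<in> borel_measurable Q"
  by (simp add: L2_space_def)

lemma L2_norm_nonneg[simp]: "0 \<le> L2_norm Q f"
  by (simp add: L2_norm_def)

lemma L2_norm_power2: "(L2_norm Q f)\<^sup>2 = (\<integral>x. (cmod (f x))\<^sup>2 \<partial>Q)"
  by (simp add: L2_norm_def)

lemma ennreal_L2_norm:
  assumes "f \<in> L2_space Q"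
  shows "ennreal ((L2_norm Q f)\<^sup>2) = (\<integral>\<^sup>+x. ennreal ((cmod (f x))\<^sup>2) \<partial>Q)"
  unfolding L2_norm_power2 using assms
  by (intro nn_integral_eq_integral[symmetric]) (auto simp: L2_space_def)

text \<open>Membership and norm bound come out of a single bound on a nonnegative integral, so
  integrability never has to be shown first.\<close>

lemma L2_space_norm_leI:
  assumes [measurable]: "f \<in> borel_measurable Q" and "0 \<le> B"
    and le: "(\<integral>\<^sup>+x. ennreal ((cmod (f x))\<^sup>2) \<partial>Q) \<le> ennreal (B\<^sup>2)"
  shows "f \<in> L2_space Q" "L2_norm Q f \<le> B"
proof -
  show f: "f \<in> L2_space Q"
    using le by (auto simp: L2_space_iff intro: le_less_trans)
  have "ennreal ((L2_norm Q f)\<^sup>2) \<le> ennreal (B\<^sup>2)"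
    using le ennreal_L2_norm[OF f] by simp
  then have "(L2_norm Q f)\<^sup>2 \<le> B\<^sup>2"
    by (simp add: ennreal_le_iff)
  then show "L2_norm Q f \<le> B"
    using \<open>0 \<le> B\<close> by (rule power2_le_imp_le)
qed

lemma L2_space_add:
  assumes "f \<in> L2_space Q" "g \<in> L2_space Q"
  shows "(\<lambda>x. f x + g x) \<in> L2_space Q"
proof -
  have [measurable]: "f \<in> borel_measurable Q" "g \<in> borel_measurable Q"
    using assms by (auto simp: L2_space_def)
  have *: "(cmod (u + v))\<^sup>2 \<le> 2 * (cmod u)\<^sup>2 + 2 * (cmod v)\<^sup>2" for u v
  proof -
    have "(cmod (u + v))\<^sup>2 \<le> (cmod u + cmod v)\<^sup>2"
      by (intro power_mono norm_triangle_ineq) simp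
    also have "\<dots> \<le> 2 * (cmod u)\<^sup>2 + 2 * (cmod v)\<^sup>2"
      using sum_squares_bound[of "cmod u" "cmod v"] by (simp add: power2_sum)
    finally show ?thesis .
  qed
  have "integrable Q (\<lambda>x. 2 * (cmod (f x))\<^sup>2 + 2 * (cmod (g x))\<^sup>2)"
    using assms by (auto simp: L2_space_def)
  then have "integrable Q (\<lambda>x. (cmod (f x + g x))\<^sup>2)"
    by (rule Bochner_Integration.integrable_bound) (auto simp: *)
  then show ?thesis
    by (simp add: L2_space_def)
qed

lemma L2_space_cmult: "f \<in> L2_space Q \<Longrightarrow> (\<lambda>x. c * f x) \<in> L2_space Q"
  by (auto simp: L2_space_def norm_mult power_mult_distrib)

lemma L2_norm_cmult: "L2_norm Q (\<lambda>x. c * f x) = cmod c * L2_norm Q f"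
  by (simp add: L2_norm_def norm_mult power_mult_distrib real_sqrt_mult)

lemma L2_space_zero: "(\<lambda>x. 0) \<in> L2_space Q"
  by (simp add: L2_space_def)

lemma L2_space_diff:
  assumes "f \<in> L2_space Q" "g \<in> L2_space Q"
  shows "(\<lambda>x. f x - g x) \<in> L2_space Q"
  using L2_space_add[OF assms(1) L2_space_cmult[OF assms(2), of "-1"]] by simp

lemma L2_space_sum:
  assumes "\<And>i. i \<in> I \<Longrightarrow> f i \<in> L2_space Q"
  shows "(\<lambda>x. \<Sum>i\<in>I. f i x) \<in> L2_space Q"
  using assms
  by (induction I rule: infinite_finite_induct) (auto intro: L2_space_add L2_space_zero)

lemma L2_space_cnj: "f \<in> L2_space Q \<Longrightarrow> (\<lambda>x. cnj (f x)) \<in> L2_space Q"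
  unfolding L2_space_def
  by (auto intro: measurable_compose[OF _ borel_measurable_continuous_onI[of cnj]] continuous_intros)

lemma L2_norm_cong_AE:
  assumes "f \<in> borel_measurable Q" "g \<in> borel_measurable Q" "AE x in Q. f x = g x"
  shows "L2_norm Q f = L2_norm Q g"
  unfolding L2_norm_def using assms by (intro arg_cong[where f=sqrt] integral_cong_AE) auto

lemma L2_norm_eq_0D:
  assumes "f \<in> L2_space Q" "L2_norm Q f = 0"
  shows "AE x in Q. f x = 0"
proof -
  have [measurable]: "f \<in> borel_measurable Q"
    using assms by (auto simp: L2_space_def)
  have "(\<integral>\<^sup>+x. ennreal ((cmod (f x))\<^sup>2) \<partial>Q) = 0"
    using ennreal_L2_norm[OF assms(1)] assms(2) by simp
  then have "AE x in Q. ennreal ((cmod (f x))\<^sup>2) = 0"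
    by (subst (asm) nn_integral_0_iff_AE) auto
  then show ?thesis
    by (rule AE_mp) (auto intro!: AE_I2)
qed

lemma ennreal_power2_le_imp_le:
  assumes "x\<^sup>2 \<le> (ennreal b)\<^sup>2" "0 \<le> b"
  shows "x \<le> ennreal b"
proof (cases x)
  case (real r)
  then show ?thesis
    using assms power2_le_imp_le[of r b] by (simp add: ennreal_power ennreal_le_iff ennreal_leI)
next
  case top
  then show ?thesis
    using assms by (simp add: ennreal_power top_unique)
qed

text \<open>The inequality is taken for nonnegative extended integrals, where integrability is no
  issue; its finite right-hand side then yields the integrability of the product.\<close>

lemma L2_Cauchy_Schwarz:
  assumes "f \<in> L2_space Q" "g \<in> L2_space Q"
  shows L2_integrable_mult: "integrable Q (\<lambda>x. f x * g x)"
    and L2_integral_norm_mult_le: "(\<integral>x. cmod (f x) * cmod (g x) \<partial>Q) \<le> L2_norm Q f * L2_norm Q g"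
proof -
  have [measurable]: "f \<in> borel_measurable Q" "g \<in> borel_measurable Q"
    using assms by (auto simp: L2_space_def)
  have "(\<integral>\<^sup>+x. ennreal (cmod (f x)) * ennreal (cmod (g x)) \<partial>Q)\<^sup>2 \<le>
    (\<integral>\<^sup>+x. (ennreal (cmod (f x)))\<^sup>2 \<partial>Q) * (\<integral>\<^sup>+x. (ennreal (cmod (g x)))\<^sup>2 \<partial>Q)"
    by (intro Cauchy_Schwarz_nn_integral) auto
  also have "\<dots> = ennreal ((L2_norm Q f)\<^sup>2) * ennreal ((L2_norm Q g)\<^sup>2)"
    using assms by (simp add: ennreal_L2_norm ennreal_power)
  also have "\<dots> = (ennreal (L2_norm Q f * L2_norm Q g))\<^sup>2"
    by (simp add: ennreal_mult'' ennreal_power power_mult_distrib)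
  finally have *: "(\<integral>\<^sup>+x. ennreal (cmod (f x)) * ennreal (cmod (g x)) \<partial>Q) \<le> ennreal (L2_norm Q f * L2_norm Q g)"
    by (rule ennreal_power2_le_imp_le) simp
  then have *: "(\<integral>\<^sup>+x. ennreal (cmod (f x * g x)) \<partial>Q) \<le> ennreal (L2_norm Q f * L2_norm Q g)"
    by (simp add: norm_mult ennreal_mult'')
  show int: "integrable Q (\<lambda>x. f x * g x)"
    using * by (intro integrableI_bounded) (auto intro: le_less_trans)
  have "ennreal (\<integral>x. cmod (f x * g x) \<partial>Q) \<le> ennreal (L2_norm Q f * L2_norm Q g)"
    using * int by (subst nn_integral_eq_integral[symmetric]) auto
  then show "(\<integral>x. cmod (f x) * cmod (g x) \<partial>Q) \<le> L2_norm Q f * L2_norm Q g"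
    by (simp add: norm_mult)
qed

lemma L2_norm_triangle:
  assumes "f \<in> L2_space Q" "g \<in> L2_space Q"
  shows "L2_norm Q (\<lambda>x. f x + g x) \<le> L2_norm Q f + L2_norm Q g"
proof (rule power2_le_imp_le)
  have int: "integrable Q (\<lambda>x. cmod (f x) * cmod (g x))"
    using integrable_norm[OF L2_integrable_mult[OF assms]] by (simp add: norm_mult)
  have intf: "integrable Q (\<lambda>x. (cmod (f x))\<^sup>2)" "integrable Q (\<lambda>x. (cmod (g x))\<^sup>2)"
    using assms by (auto simp: L2_space_def)
  have "(L2_norm Q (\<lambda>x. f x + g x))\<^sup>2 = (\<integral>x. (cmod (f x + g x))\<^sup>2 \<partial>Q)"
    by (rule L2_norm_power2)
  also have "\<dots> \<le> (\<integral>x. (cmod (f x))\<^sup>2 + (cmod (g x))\<^sup>2 + 2 * (cmod (f x) * cmod (g x)) \<partial>Q)"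
  proof (intro integral_mono)
    show "integrable Q (\<lambda>x. (cmod (f x + g x))\<^sup>2)"
      using L2_space_add[OF assms] by (auto simp: L2_space_def)
    show "integrable Q (\<lambda>x. (cmod (f x))\<^sup>2 + (cmod (g x))\<^sup>2 + 2 * (cmod (f x) * cmod (g x)))"
      using int intf by auto
    fix x
    have "(cmod (f x + g x))\<^sup>2 \<le> (cmod (f x) + cmod (g x))\<^sup>2"
      by (intro power_mono norm_triangle_ineq) simp
    then show "(cmod (f x + g x))\<^sup>2 \<le> (cmod (f x))\<^sup>2 + (cmod (g x))\<^sup>2 + 2 * (cmod (f x) * cmod (g x))"
      by (simp add: power2_sum)
  qed
  also have "\<dots> = (L2_norm Q f)\<^sup>2 + (L2_norm Q g)\<^sup>2 + 2 * (\<integral>x. cmod (f x) * cmod (g x) \<partial>Q)"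
    using int intf by (simp add: L2_norm_power2)
  also have "\<dots> \<le> (L2_norm Q f + L2_norm Q g)\<^sup>2"
    using L2_integral_norm_mult_le[OF assms] by (simp add: power2_sum)
  finally show "(L2_norm Q (\<lambda>x. f x + g x))\<^sup>2 \<le> (L2_norm Q f + L2_norm Q g)\<^sup>2" .
qed simp

lemma L2_norm_diff_triangle:
  assumes "f \<in> L2_space Q" "g \<in> L2_space Q"
  shows "L2_norm Q (\<lambda>x. f x - g x) \<le> L2_norm Q f + L2_norm Q g"
  using L2_norm_triangle[OF assms(1) L2_space_cmult[OF assms(2), of "-1"]] L2_norm_cmult[of Q "-1" g]
  by simp

lemma L2_norm_sum_le:
  assumes "\<And>i. i \<in> I \<Longrightarrow> f i \<in> L2_space Q"
  shows "L2_norm Q (\<lambda>x. \<Sum>i\<in>I. f i x) \<le> (\<Sum>i\<in>I. L2_norm Q (f i))"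
  using assms
proof (induction I rule: infinite_finite_induct)
  case (insert i I)
  have "L2_norm Q (\<lambda>x. f i x + (\<Sum>i\<in>I. f i x)) \<le> L2_norm Q (f i) + L2_norm Q (\<lambda>x. \<Sum>i\<in>I. f i x)"
    using insert.prems by (intro L2_norm_triangle L2_space_sum) auto
  with insert show ?case by fastforce
qed (auto simp: L2_norm_def)

lemma L2_inner_self: "L2_inner Q f f = complex_of_real ((L2_norm Q f)\<^sup>2)"
  unfolding L2_inner_def L2_norm_power2 complex_norm_square[symmetric] of_real_power[symmetric]
  by (rule integral_complex_of_real)

lemma norm_L2_inner_le:
  assumes "f \<in> L2_space Q" "g \<in> L2_space Q"
  shows "cmod (L2_inner Q f g) \<le> L2_norm Q f * L2_norm Q g"
proof -
  have "cmod (L2_inner Q f g) \<le> (\<integral>x. cmod (f x * cnj (g x)) \<partial>Q)"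
    unfolding L2_inner_def by (rule integral_norm_bound)
  also have "\<dots> \<le> L2_norm Q f * L2_norm Q g"
    using L2_integral_norm_mult_le[OF assms] by (simp add: norm_mult)
  finally show ?thesis .
qed

lemma L2_inner_diff_right:
  assumes "f \<in> L2_space Q" "g \<in> L2_space Q" "h \<in> L2_space Q"
  shows "L2_inner Q f (\<lambda>x. g x - h x) = L2_inner Q f g - L2_inner Q f h"
  using L2_integrable_mult[OF assms(1) L2_space_cnj[OF assms(2)]]
    L2_integrable_mult[OF assms(1) L2_space_cnj[OF assms(3)]]
  unfolding L2_inner_def by (simp add: algebra_simps)

lemma L2_inner_add_right:
  assumes "f \<in> L2_space Q" "g \<in> L2_space Q" "h \<in> L2_space Q"
  shows "L2_inner Q f (\<lambda>x. g x + h x) = L2_inner Q f g + L2_inner Q f h"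
  using L2_integrable_mult[OF assms(1) L2_space_cnj[OF assms(2)]]
    L2_integrable_mult[OF assms(1) L2_space_cnj[OF assms(3)]]
  unfolding L2_inner_def by (simp add: algebra_simps)

lemma L2_inner_cmult_right: "L2_inner Q f (\<lambda>x. c * g x) = cnj c * L2_inner Q f g"
  unfolding L2_inner_def by (simp add: algebra_simps flip: integral_mult_right_zero)

text \<open>Testing with \<open>g - h\<close> itself makes its norm vanish. This turns weak
  identities for an adjoint into identities almost everywhere.\<close>

lemma L2_eq_AE_I:
  assumes "g \<in> L2_space Q" "h \<in> L2_space Q"
    and "\<And>f. f \<in> L2_space Q \<Longrightarrow> L2_inner Q f g = L2_inner Q f h"
  shows "AE x in Q. g x = h x"
proof -
  let ?d = "\<lambda>x. g x - h x"
  have d: "?d \<in> L2_space Q" by (intro L2_space_diff assms)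
  have "L2_inner Q ?d ?d = 0"
    using L2_inner_diff_right[OF d assms(1,2)] assms(3)[OF d] by simp
  then have "L2_norm Q ?d = 0"
    by (simp add: L2_inner_self)
  from L2_norm_eq_0D[OF d this] show ?thesis
    by simp
qed

section \<open>Contractions of \<open>L\<^sup>2\<close> and the Neumann series\<close>

text \<open>The bound is 1 rather than an arbitrary operator bound: this class is stable under
  composition, powers and adjoints, and it confines the spectrum to the closed unit disc.\<close>

definition L2_contraction :: "'a measure \<Rightarrow> (('a \<Rightarrow> complex) \<Rightarrow> ('a \<Rightarrow> complex)) \<Rightarrow> bool" where
  "L2_contraction Q T \<longleftrightarrow>
     L2_bounded_operator Q T \<and> (\<forall>f\<in>L2_space Q. L2_norm Q (T f) \<le> L2_norm Q f)"

lemma L2_bounded_operatorD: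
  assumes "L2_bounded_operator Q T" "f \<in> L2_space Q"
  shows "T f \<in> L2_space Q"
    and "g \<in> L2_space Q \<Longrightarrow> AE x in Q. f x = g x \<Longrightarrow> AE x in Q. T f x = T g x"
    and "g \<in> L2_space Q \<Longrightarrow> AE x in Q. T (\<lambda>z. f z + g z) x = T f x + T g x"
    and "AE x in Q. T (\<lambda>z. c * f z) x = c * T f x"
  using assms unfolding L2_bounded_operator_def by blast+

lemma L2_contraction_id: "L2_contraction Q id"
  by (auto simp: L2_contraction_def L2_bounded_operator_def intro!: exI[of _ 1])

lemma L2_contraction_comp:
  assumes "L2_contraction Q T" "L2_contraction Q U"
  shows "L2_contraction Q (T \<circ> U)"
proof -
  have T: "L2_bounded_operator Q T" "\<And>f. f \<in> L2_space Q \<Longrightarrow> L2_norm Q (T f) \<le> L2_norm Q f"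
   and U: "L2_bounded_operator Q U" "\<And>f. f \<in> L2_space Q \<Longrightarrow> L2_norm Q (U f) \<le> L2_norm Q f"
    using assms by (auto simp: L2_contraction_def)
  note TD = L2_bounded_operatorD[OF T(1)] and UD = L2_bounded_operatorD[OF U(1)]
  have le: "L2_norm Q (T (U f)) \<le> L2_norm Q f" if "f \<in> L2_space Q" for f
    using T(2)[OF UD(1)[OF that]] U(2)[OF that] by simp
  have "AE x in Q. T (U (\<lambda>z. f z + g z)) x = T (U f) x + T (U g) x"
    if f: "f \<in> L2_space Q" and g: "g \<in> L2_space Q" for f g
    using TD(2)[OF UD(1)[OF L2_space_add[OF f g]] L2_space_add[OF UD(1)[OF f] UD(1)[OF g]] UD(3)[OF f g]]
      TD(3)[OF UD(1)[OF f] UD(1)[OF g]] by eventually_elim simp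
  moreover have "AE x in Q. T (U (\<lambda>z. c * f z)) x = c * T (U f) x"
    if f: "f \<in> L2_space Q" for f c
    using TD(2)[OF UD(1)[OF L2_space_cmult[OF f]] L2_space_cmult[OF UD(1)[OF f]] UD(4)[OF f, of c]]
      TD(4)[OF UD(1)[OF f], of c] by eventually_elim simp
  moreover have "AE x in Q. T (U f) x = T (U g) x"
    if "f \<in> L2_space Q" "g \<in> L2_space Q" "AE x in Q. f x = g x" for f g
    using that by (intro TD(2) UD(1,2))
  ultimately show ?thesis
    using le TD(1) UD(1) unfolding L2_contraction_def L2_bounded_operator_def
    by (auto intro!: exI[of _ 1])
qed

lemma L2_contraction_funpow: "L2_contraction Q T \<Longrightarrow> L2_contraction Q (T ^^ k)"
  by (induction k) (auto intro: L2_contraction_id L2_contraction_comp)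

text \<open>Completeness of L2 in the form that the Neumann series uses. On a probability space the
  L2 norm dominates the L1 norm, which gives absolute convergence almost everywhere; Fatou's lemma
  then carries the norm bound of the partial sums to the limit.\<close>

lemma (in prob_space) L2_series:
  fixes u :: "nat \<Rightarrow> 'a \<Rightarrow> complex"
  assumes u: "\<And>k. u k \<in> L2_space M" and le: "\<And>k. L2_norm M (u k) \<le> b k" and b: "summable b"
  shows L2_series_summable: "AE x in M. summable (\<lambda>k. u k x)"
    and L2_series_in_L2: "(\<lambda>x. \<Sum>k. u k x) \<in> L2_space M"
    and L2_series_norm_le: "L2_norm M (\<lambda>x. \<Sum>k. u k x) \<le> (\<Sum>k. b k)"
proof -
  have [measurable]: "u k \<in> borel_measurable M" for k
    using u by (auto simp: L2_space_def)
  have b0: "0 \<le> b k" for k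
    using le[of k] L2_norm_nonneg[of M "u k"] by linarith
  have one: "(\<lambda>x. 1) \<in> L2_space M" "L2_norm M (\<lambda>x. 1) = 1"
    by (auto simp: L2_space_def L2_norm_def prob_space)
  have "(\<integral>\<^sup>+x. ennreal (cmod (u k x)) \<partial>M) \<le> ennreal (b k)" for k
  proof -
    have "(\<integral>\<^sup>+x. ennreal (cmod (u k x)) \<partial>M) = ennreal (\<integral>x. cmod (u k x) \<partial>M)"
      using L2_integrable_mult[OF u[of k] one(1)] by (intro nn_integral_eq_integral) auto
    also have "\<dots> \<le> ennreal (b k)"
      using L2_integral_norm_mult_le[OF u[of k] one(1)] le[of k] one(2) by (intro ennreal_leI) auto
    finally show ?thesis .
  qed
  then have "(\<Sum>k. \<integral>\<^sup>+x. ennreal (cmod (u k x)) \<partial>M) \<le> (\<Sum>k. ennreal (b k))"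
    by (intro suminf_le) auto
  also have "\<dots> < \<infinity>"
    using b b0 by (simp add: suminf_ennreal_eq[OF _ summable_sums])
  finally have "(\<integral>\<^sup>+x. (\<Sum>k. ennreal (cmod (u k x))) \<partial>M) < \<infinity>"
    by (subst nn_integral_suminf) auto
  then have "AE x in M. (\<Sum>k. ennreal (cmod (u k x))) \<noteq> \<infinity>"
    by (intro nn_integral_PInf_AE) auto
  then show summ: "AE x in M. summable (\<lambda>k. u k x)"
  proof (rule AE_mp, intro AE_I2 impI)
    fix x assume "(\<Sum>k. ennreal (cmod (u k x))) \<noteq> \<infinity>"
    then have "summable (\<lambda>k. cmod (u k x))"
      by (intro summable_suminf_not_top) auto
    then show "summable (\<lambda>k. u k x)"
      by (rule summable_norm_cancel)
  qed
  let ?U = "\<lambda>x. \<Sum>k. u k x"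
  have part: "(\<integral>\<^sup>+x. ennreal ((cmod (\<Sum>k<n. u k x))\<^sup>2) \<partial>M) \<le> ennreal ((\<Sum>k. b k)\<^sup>2)" for n
  proof -
    have "L2_norm M (\<lambda>x. \<Sum>k<n. u k x) \<le> (\<Sum>k<n. b k)"
      using L2_norm_sum_le[of "{..<n}" u M] u by (intro order.trans[OF _ sum_mono[OF le]]) auto
    also have "\<dots> \<le> (\<Sum>k. b k)"
      using b b0 by (intro sum_le_suminf) auto
    finally show ?thesis
      by (subst ennreal_L2_norm[symmetric]) (auto intro!: L2_space_sum u ennreal_leI power_mono)
  qed
  have "(\<integral>\<^sup>+x. ennreal ((cmod (?U x))\<^sup>2) \<partial>M) =
      (\<integral>\<^sup>+x. liminf (\<lambda>n. ennreal ((cmod (\<Sum>k<n. u k x))\<^sup>2)) \<partial>M)"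
    using summ
  proof (intro nn_integral_cong_AE, eventually_elim)
    fix x assume "summable (\<lambda>k. u k x)"
    then have "(\<lambda>n. \<Sum>k<n. u k x) \<longlonglongrightarrow> ?U x"
      by (rule summable_LIMSEQ)
    then have "(\<lambda>n. ennreal ((cmod (\<Sum>k<n. u k x))\<^sup>2)) \<longlonglongrightarrow> ennreal ((cmod (?U x))\<^sup>2)"
      by (intro tendsto_intros)
    then show "ennreal ((cmod (?U x))\<^sup>2) = liminf (\<lambda>n. ennreal ((cmod (\<Sum>k<n. u k x))\<^sup>2))"
      by (rule lim_imp_Liminf[symmetric, rotated]) simp
  qed
  also have "\<dots> \<le> liminf (\<lambda>n. \<integral>\<^sup>+x. ennreal ((cmod (\<Sum>k<n. u k x))\<^sup>2) \<partial>M)"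
    by (intro nn_integral_liminf) auto
  also have "\<dots> \<le> liminf (\<lambda>n::nat. ennreal ((\<Sum>k. b k)\<^sup>2))"
    by (intro Liminf_mono always_eventually allI part)
  also have "\<dots> = ennreal ((\<Sum>k. b k)\<^sup>2)"
    by (simp add: Liminf_const)
  finally have "(\<integral>\<^sup>+x. ennreal ((cmod (?U x))\<^sup>2) \<partial>M) \<le> ennreal ((\<Sum>k. b k)\<^sup>2)" .
  then show "?U \<in> L2_space M" "L2_norm M ?U \<le> (\<Sum>k. b k)"
    using b b0 by (auto intro!: L2_space_norm_leI[where B="\<Sum>k. b k"] suminf_nonneg)
qed

text \<open>The resolvent at \<open>l\<close> is the series of \<open>(1 / l) ^ Suc k\<close> times
  \<open>T ^^ k\<close>, which converges since the powers of \<open>T\<close> have norm at most 1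
  and \<open>q = 1 / cmod l\<close> is below 1.\<close>

lemma (in prob_space) L2_contraction_Neumann:
  assumes T: "L2_contraction M T" and l: "1 < cmod l"
  shows "l \<notin> S2 M T"
proof -
  have l0: "l \<noteq> 0" using l by auto
  define q where "q = 1 / cmod l"
  have q: "0 < q" "q < 1" using l l0 by (auto simp: q_def divide_less_eq)
  note Tk = L2_contraction_funpow[OF T]
  have TD: "L2_bounded_operator M (T ^^ k)" "f \<in> L2_space M \<Longrightarrow> L2_norm M ((T ^^ k) f) \<le> L2_norm M f" for f k
    using Tk[of k] by (auto simp: L2_contraction_def)
  note D = L2_bounded_operatorD[OF TD(1)]
  have T1: "L2_bounded_operator M T" "f \<in> L2_space M \<Longrightarrow> L2_norm M (T f) \<le> L2_norm M f" for f
    using T by (auto simp: L2_contraction_def)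
  note D1 = L2_bounded_operatorD[OF T1(1)]
  define u where "u f k x = (1 / l) ^ Suc k * (T ^^ k) f x" for f k x
  define R where "R f x = (\<Sum>k. u f k x)" for f x
  have u_L2: "u f k \<in> L2_space M" if "f \<in> L2_space M" for f k
    unfolding u_def[abs_def] by (intro L2_space_cmult D that)
  have u_norm: "L2_norm M (u f k) \<le> L2_norm M f * q ^ Suc k" if "f \<in> L2_space M" for f k
    using TD(2)[OF that, of k] q unfolding u_def[abs_def] L2_norm_cmult
    by (simp add: norm_power norm_divide q_def[symmetric] mult.commute mult_right_mono del: power_Suc)
  have summ_q: "summable (\<lambda>k. c * q ^ Suc k)" for c :: real
    using q by (intro summable_mult) (simp add: summable_geometric summable_mult)
  note ser = L2_series[where u="u f" and b="\<lambda>k. L2_norm M f * q ^ Suc k" for f, OF u_L2 u_norm summ_q]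
  have R_L2: "R f \<in> L2_space M" if "f \<in> L2_space M" for f
    using ser(2)[OF that that] by (simp add: R_def[abs_def])
  have R_bound: "L2_norm M (R f) \<le> (\<Sum>k. q ^ Suc k) * L2_norm M f" if "f \<in> L2_space M" for f
    using ser(3)[OF that that] summ_q[of 1]
    by (simp add: R_def[abs_def] suminf_mult mult.commute del: power_Suc)
  \<comment> \<open>\<open>T\<close> can be exchanged with finite sums only, so the identity for
    \<open>l * R f - T (R f)\<close> is later obtained from partial sums; this quantifies their
    error.\<close>
  have R_tail: "L2_norm M (\<lambda>x. R f x - (\<Sum>k<n. u f k x)) \<le> L2_norm M f * (\<Sum>k. q ^ Suc (k + n))"
    if f: "f \<in> L2_space M" for f n
  proof -
    have *: "summable (\<lambda>k. L2_norm M f * q ^ Suc (k + n))"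
      using summable_ignore_initial_segment[OF summ_q[of "L2_norm M f"], of n] by simp
    have m: "L2_norm M (\<lambda>x. \<Sum>k. u f (k + n) x) \<le> (\<Sum>k. L2_norm M f * q ^ Suc (k + n))"
      by (rule L2_series(3)[OF u_L2[OF f] u_norm[OF f] *])
    have mL2: "(\<lambda>x. \<Sum>k. u f (k + n) x) \<in> L2_space M"
      by (rule L2_series(2)[OF u_L2[OF f] u_norm[OF f] *])
    have "AE x in M. R f x - (\<Sum>k<n. u f k x) = (\<Sum>k. u f (k + n) x)"
      using ser(1)[OF f f] by eventually_elim (simp add: R_def suminf_split_initial_segment[of _ n])
    then have "L2_norm M (\<lambda>x. R f x - (\<Sum>k<n. u f k x)) = L2_norm M (\<lambda>x. \<Sum>k. u f (k + n) x)"
      by (intro L2_norm_cong_AE L2_space_measurable L2_space_diff L2_space_sum mL2 R_L2 u_L2 f)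
    also have "\<dots> \<le> L2_norm M f * (\<Sum>k. q ^ Suc (k + n))"
      using m summable_ignore_initial_segment[OF summ_q[of 1], of n]
      by (simp add: suminf_mult del: power_Suc)
    finally show ?thesis .
  qed
  have tail0: "(\<lambda>n. \<Sum>k. q ^ Suc (k + n)) \<longlonglongrightarrow> 0"
    using suminf_exist_split2[OF summ_q[of 1]] by simp
  have qn0: "(\<lambda>n. q ^ n) \<longlonglongrightarrow> 0"
    using q by (intro LIMSEQ_power_zero) auto
  have "L2_bounded_operator M R"
    unfolding L2_bounded_operator_def
  proof (intro conjI ballI allI impI)
    fix f g assume f: "f \<in> L2_space M" and g: "g \<in> L2_space M"
    { assume "AE x in M. f x = g x"
      then have "AE x in M. (T ^^ k) f x = (T ^^ k) g x" for k
        by (intro D f g)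
      \<comment> \<open>Countably many exceptional null sets are merged, so that whole series can be
        compared at a single point.\<close>
      then have "AE x in M. \<forall>k. (T ^^ k) f x = (T ^^ k) g x"
        by (simp add: AE_all_countable)
      then show "AE x in M. R f x = R g x"
        by eventually_elim (simp add: R_def u_def) }
    have "AE x in M. \<forall>k. (T ^^ k) (\<lambda>z. f z + g z) x = (T ^^ k) f x + (T ^^ k) g x"
      unfolding AE_all_countable by (intro allI D f g)
    then show "AE x in M. R (\<lambda>z. f z + g z) x = R f x + R g x"
      using ser(1)[OF f f] ser(1)[OF g g]
      by eventually_elim (simp add: R_def u_def distrib_left suminf_add del: power_Suc)
  next
    fix f c assume f: "f \<in> L2_space M"
    have "AE x in M. \<forall>k. (T ^^ k) (\<lambda>z. c * f z) x = c * (T ^^ k) f x"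
      unfolding AE_all_countable by (intro allI D f)
    then show "AE x in M. R (\<lambda>z. c * f z) x = c * R f x"
      using ser(1)[OF f f]
      by eventually_elim (simp add: R_def u_def mult.left_commute[of _ c] suminf_mult del: power_Suc)
  qed (use R_L2 R_bound in auto)
  moreover have "AE x in M. R (\<lambda>z. l * f z - T f z) x = f x" if f: "f \<in> L2_space M" for f
  proof -
    have Tf: "T f \<in> L2_space M" by (intro D1 f)
    \<comment> \<open>Subtraction is treated as adding the multiple by \<open>-1\<close>, since
      operators are given as additive and homogeneous up to null sets.\<close>
    have "AE x in M. (T ^^ k) (\<lambda>z. l * f z - T f z) x = l * (T ^^ k) f x - (T ^^ Suc k) f x" for k
      using D(3)[OF L2_space_cmult[OF f] L2_space_cmult[OF Tf], of k l "-1"] D(4)[OF f, of k l]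
        D(4)[OF Tf, of k "-1"]
      by eventually_elim (simp add: funpow_swap1)
    then have "AE x in M. \<forall>k. (T ^^ k) (\<lambda>z. l * f z - T f z) x = l * (T ^^ k) f x - (T ^^ Suc k) f x"
      unfolding AE_all_countable by blast
    then show ?thesis
      using ser(1)[OF f f]
    proof eventually_elim
      case (elim x)
      \<comment> \<open>The series telescopes to its first term \<open>l * u f 0 x\<close>, which is
        \<open>f x\<close>, because its terms tend to 0.\<close>
      have "(\<lambda>k. l * u f k x) \<longlonglongrightarrow> l * 0"
        by (intro tendsto_mult tendsto_const summable_LIMSEQ_zero elim)
      then have "(\<lambda>k. l * u f k x - l * u f (Suc k) x) sums (l * u f 0 x - 0)"
        by (intro telescope_sums') simp
      moreover have "l * u f k x - l * u f (Suc k) x = u (\<lambda>z. l * f z - T f z) k x" for k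
        using elim(1) l0 by (simp add: u_def field_simps)
      ultimately have "(\<lambda>k. u (\<lambda>z. l * f z - T f z) k x) sums f x"
        using l0 by (simp add: u_def)
      then show ?case
        unfolding R_def by (rule sums_unique[symmetric])
    qed
  qed
  moreover have "AE x in M. l * R f x - T (R f) x = f x" if f: "f \<in> L2_space M" for f
  proof -
    define S where "S n x = (\<Sum>k<n. u f k x)" for n x
    have S: "S n \<in> L2_space M" for n
      unfolding S_def[abs_def] by (intro L2_space_sum u_L2 f)
    \<comment> \<open>The finite geometric identity: the defect of the \<open>n\<close>-th partial
      sum is the single remainder \<open>(1 / l) ^ n * (T ^^ n) f x\<close>, which tends to 0 in
      L2.\<close>
    have TS: "AE x in M. l * S n x - T (S n) x = f x - (1 / l) ^ n * (T ^^ n) f x" for n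
    proof (induction n)
      case 0
      \<comment> \<open>Homogeneity with the scalar 0 shows that \<open>T\<close> maps the zero
        function to 0.\<close>
      have "AE x in M. T (\<lambda>z. 0 * f z) x = 0 * T f x"
        by (intro D1 f)
      then show ?case
        by (simp add: S_def[abs_def])
    next
      case (Suc n)
      have Sn: "S (Suc n) = (\<lambda>x. S n x + u f n x)"
        by (auto simp: S_def)
      have Tu: "AE x in M. T (u f n) x = (1 / l) ^ Suc n * T ((T ^^ n) f) x"
        unfolding u_def[abs_def] by (intro D1 D f)
      show ?case
        using Suc D1(3)[OF S u_L2[OF f], of n n] Tu unfolding Sn
      proof eventually_elim
        case (elim x)
        have "l * (S n x + u f n x) - T (\<lambda>x. S n x + u f n x) x =
            (l * S n x - T (S n) x) + l * u f n x - T (u f n) x"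
          by (simp add: elim(2) algebra_simps)
        also have "\<dots> = f x - (1 / l) ^ Suc n * (T ^^ Suc n) f x"
          unfolding elim(1,3) using l0 by (simp add: u_def)
        finally show ?case .
      qed
    qed
    \<comment> \<open>\<open>E\<close> is the defect of \<open>R f\<close> itself. Its norm does not
      depend on \<open>n\<close>, while the bound below tends to 0 as \<open>n\<close>
      grows.\<close>
    define E where "E x = (l * R f x + (-1) * T (R f) x) + (-1) * f x" for x
    have TR: "T (R f) \<in> L2_space M"
      by (intro D1 R_L2 f)
    have E: "E \<in> L2_space M"
      unfolding E_def[abs_def] by (intro L2_space_add L2_space_cmult TR R_L2 f)
    have bound: "L2_norm M E \<le> (cmod l + 1) * (L2_norm M f * (\<Sum>k. q ^ Suc (k + n))) + L2_norm M f * q ^ n" for n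
    proof -
      let ?d = "\<lambda>x. R f x - S n x" and ?e = "\<lambda>x. (1 / l) ^ n * (T ^^ n) f x"
      have d: "?d \<in> L2_space M" by (intro L2_space_diff R_L2 S f)
      have Td: "T ?d \<in> L2_space M" by (intro D1 d)
      have e: "?e \<in> L2_space M" by (intro L2_space_cmult D f)
      have ld: "(\<lambda>x. l * ?d x - T ?d x) \<in> L2_space M"
        by (intro L2_space_diff L2_space_cmult Td d)
      have "AE x in M. T (\<lambda>x. ?d x + S n x) x = T ?d x + T (S n) x"
        by (intro D1 d S)
      then have "AE x in M. E x = (l * ?d x - T ?d x) - ?e x"
        using TS[of n] by eventually_elim (simp add: E_def algebra_simps)
      then have "L2_norm M E = L2_norm M (\<lambda>x. (l * ?d x - T ?d x) - ?e x)"
        using E L2_space_diff[OF ld e] by (intro L2_norm_cong_AE) (auto simp: L2_space_def)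
      also have "\<dots> \<le> L2_norm M (\<lambda>x. l * ?d x - T ?d x) + L2_norm M ?e"
        by (intro L2_norm_diff_triangle ld e)
      also have "L2_norm M (\<lambda>x. l * ?d x - T ?d x) \<le> L2_norm M (\<lambda>x. l * ?d x) + L2_norm M (T ?d)"
        by (intro L2_norm_diff_triangle L2_space_cmult d Td)
      also have "\<dots> \<le> (cmod l + 1) * L2_norm M ?d"
        using T1(2)[OF d] unfolding L2_norm_cmult by (simp add: distrib_right)
      also have "\<dots> \<le> (cmod l + 1) * (L2_norm M f * (\<Sum>k. q ^ Suc (k + n)))"
        using R_tail[OF f, of n] by (intro mult_left_mono) (auto simp: S_def)
      also have "L2_norm M ?e \<le> L2_norm M f * q ^ n"
        using TD(2)[OF f, of n] q unfolding L2_norm_cmult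
        by (simp add: norm_power norm_divide q_def[symmetric] mult.commute mult_right_mono)
      finally show ?thesis by simp
    qed
    have "(\<lambda>n. (cmod l + 1) * (L2_norm M f * (\<Sum>k. q ^ Suc (k + n))) + L2_norm M f * q ^ n)
        \<longlonglongrightarrow> (cmod l + 1) * (L2_norm M f * 0) + L2_norm M f * 0"
      by (intro tendsto_intros tail0 qn0)
    then have "L2_norm M E \<le> 0"
      using bound by (intro LIMSEQ_le_const[where X="\<lambda>n. (cmod l + 1) * (L2_norm M f * (\<Sum>k. q ^ Suc (k + n))) + L2_norm M f * q ^ n"]) auto
    then have "L2_norm M E = 0"
      using L2_norm_nonneg[of M E] by linarith
    from L2_norm_eq_0D[OF E this] show ?thesis
      by (auto simp: E_def)
  qed
  ultimately show ?thesis
    by (auto simp: S2_def)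
qed

text \<open>Real points of \<open>S2\<close> lie in [-1, 1], and so does the supremum, including the
  value 0 set for the empty set. The upper bound 2 makes the family in the pseudo spectral gap
  bounded.\<close>

lemma (in prob_space) spectral_gap_contraction:
  assumes "L2_contraction M T"
  shows "0 \<le> spectral_gap M T" "spectral_gap M T \<le> 2"
proof -
  let ?R = "{r::real. complex_of_real r \<in> S2 M T \<and> r \<noteq> 1}"
  have *: "\<bar>r\<bar> \<le> 1" if "r \<in> ?R" for r
    using L2_contraction_Neumann[OF assms, of "complex_of_real r"] that by fastforce
  have "Sup ?R \<le> 1" "-1 \<le> Sup ?R" if ne: "?R \<noteq> {}"
  proof -
    show "Sup ?R \<le> 1"
      using * by (intro cSup_least ne) fastforce
    obtain r where r: "r \<in> ?R" using ne by blast
    have "r \<le> Sup ?R"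
      using * by (intro cSup_upper r bdd_aboveI[of _ 1]) fastforce
    with *[OF r] show "-1 \<le> Sup ?R" by linarith
  qed
  then show "0 \<le> spectral_gap M T" "spectral_gap M T \<le> 2"
    unfolding spectral_gap_def Let_def by (auto simp del: mem_Collect_eq)
qed

text \<open>\<open>T'\<close> is merely a map of functions here. Additivity, homogeneity and
  compatibility with null sets follow by testing against every \<open>h\<close>, and the bound
  follows from \<open>(L2_norm Q (T' g))\<^sup>2 = cmod (L2_inner Q (T (T' g)) g)\<close>.\<close>

lemma L2_contraction_adjoint:
  assumes T: "L2_contraction Q T"
    and T'_L2: "\<And>g. g \<in> L2_space Q \<Longrightarrow> T' g \<in> L2_space Q"
    and adj: "\<And>f g. f \<in> L2_space Q \<Longrightarrow> g \<in> L2_space Q \<Longrightarrow> L2_inner Q (T f) g = L2_inner Q f (T' g)"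
  shows "L2_contraction Q T'"
proof -
  have T1: "L2_bounded_operator Q T" "f \<in> L2_space Q \<Longrightarrow> L2_norm Q (T f) \<le> L2_norm Q f" for f
    using T by (auto simp: L2_contraction_def)
  note D = L2_bounded_operatorD[OF T1(1)]
  have le: "L2_norm Q (T' g) \<le> L2_norm Q g" if g: "g \<in> L2_space Q" for g
  proof (cases "L2_norm Q (T' g) = 0")
    case False
    have "(L2_norm Q (T' g))\<^sup>2 = cmod (L2_inner Q (T (T' g)) g)"
      by (simp add: adj T'_L2 g L2_inner_self norm_power)
    also have "\<dots> \<le> L2_norm Q (T (T' g)) * L2_norm Q g"
      by (intro norm_L2_inner_le D T'_L2 g)
    also have "\<dots> \<le> L2_norm Q (T' g) * L2_norm Q g"
      by (intro mult_right_mono T1 T'_L2 g) simp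
    finally show ?thesis
      using False L2_norm_nonneg[of Q "T' g"] by (simp add: power2_eq_square)
  qed simp
  have "L2_bounded_operator Q T'"
    unfolding L2_bounded_operator_def
  proof (intro conjI ballI allI impI)
    fix f g assume f: "f \<in> L2_space Q" and g: "g \<in> L2_space Q"
    show "AE x in Q. T' (\<lambda>z. f z + g z) x = T' f x + T' g x"
    proof (rule L2_eq_AE_I)
      fix h assume h: "h \<in> L2_space Q"
      then show "L2_inner Q h (T' (\<lambda>z. f z + g z)) = L2_inner Q h (\<lambda>x. T' f x + T' g x)"
        by (simp add: L2_inner_add_right T'_L2 f g D L2_space_add flip: adj)
    qed (intro T'_L2 L2_space_add f g)+
    assume fg: "AE x in Q. f x = g x"
    show "AE x in Q. T' f x = T' g x"
    proof (rule L2_eq_AE_I)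
      fix h assume h: "h \<in> L2_space Q"
      then have [measurable]: "f \<in> borel_measurable Q" "g \<in> borel_measurable Q" "T h \<in> borel_measurable Q"
        using f g D(1)[OF h] by (auto simp: L2_space_def)
      have [measurable]: "(\<lambda>x. cnj (f x)) \<in> borel_measurable Q" "(\<lambda>x. cnj (g x)) \<in> borel_measurable Q"
        using L2_space_cnj[OF f] L2_space_cnj[OF g] by (auto simp: L2_space_def)
      have "L2_inner Q (T h) f = L2_inner Q (T h) g"
        unfolding L2_inner_def using fg by (intro integral_cong_AE) auto
      then show "L2_inner Q h (T' f) = L2_inner Q h (T' g)"
        by (simp add: adj h f g)
    qed (intro T'_L2 f g)+
  next
    fix f c assume f: "f \<in> L2_space Q"
    show "AE x in Q. T' (\<lambda>z. c * f z) x = c * T' f x"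
    proof (rule L2_eq_AE_I)
      fix h assume h: "h \<in> L2_space Q"
      then show "L2_inner Q h (T' (\<lambda>z. c * f z)) = L2_inner Q h (\<lambda>x. c * T' f x)"
        by (simp add: L2_inner_cmult_right T'_L2 f D L2_space_cmult flip: adj)
    qed (intro T'_L2 L2_space_cmult f)+
  qed (use T'_L2 le in \<open>auto intro: exI[of _ 1]\<close>)
  then show ?thesis
    using le by (simp add: L2_contraction_def)
qed

text \<open>Positive and negative parts of the real and imaginary parts reduce a linear claim to
  nonnegative functions, for which densities and nonnegative integrals are available.\<close>

lemma L2_space_induct [consumes 1, case_names nonneg add cmult]:
  assumes f: "f \<in> L2_space Q"
    and nonneg: "\<And>\<phi>. (\<lambda>x. complex_of_real (\<phi> x)) \<in> L2_space Q \<Longrightarrow> (\<And>x. 0 \<le> \<phi> x) \<Longrightarrow>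
      P (\<lambda>x. complex_of_real (\<phi> x))"
    and add: "\<And>f g. f \<in> L2_space Q \<Longrightarrow> g \<in> L2_space Q \<Longrightarrow> P f \<Longrightarrow> P g \<Longrightarrow> P (\<lambda>x. f x + g x)"
    and cmult: "\<And>c f. f \<in> L2_space Q \<Longrightarrow> P f \<Longrightarrow> P (\<lambda>x. c * f x)"
  shows "P f"
proof -
  have [measurable]: "f \<in> borel_measurable Q" using f by (auto simp: L2_space_def)
  have part: "(\<lambda>x. complex_of_real (\<phi> x)) \<in> L2_space Q \<and> P (\<lambda>x. complex_of_real (\<phi> x))"
    if [measurable]: "\<phi> \<in> borel_measurable Q" and "\<And>x. 0 \<le> \<phi> x" "\<And>x. \<phi> x \<le> cmod (f x)" for \<phi>
  proof -
    have "integrable Q (\<lambda>x. (cmod (complex_of_real (\<phi> x)))\<^sup>2)"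
    proof (rule Bochner_Integration.integrable_bound)
      show "integrable Q (\<lambda>x. (cmod (f x))\<^sup>2)"
        using f by (auto simp: L2_space_def)
    qed (use that in \<open>auto intro!: AE_I2 power_mono\<close>)
    then have "(\<lambda>x. complex_of_real (\<phi> x)) \<in> L2_space Q"
      by (auto simp: L2_space_def)
    with that show ?thesis by (auto intro: nonneg)
  qed
  have re: "max 0 (Re z) \<le> cmod z" "max 0 (- Re z) \<le> cmod z" for z
    using abs_Re_le_cmod[of z] by auto
  have im: "max 0 (Im z) \<le> cmod z" "max 0 (- Im z) \<le> cmod z" for z
    using abs_Im_le_cmod[of z] by auto
  note p = part[of "\<lambda>x. max 0 (Re (f x))"] part[of "\<lambda>x. max 0 (- Re (f x))"]
    part[of "\<lambda>x. max 0 (Im (f x))"] part[of "\<lambda>x. max 0 (- Im (f x))"]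
  have "P (\<lambda>x. (complex_of_real (max 0 (Re (f x))) + (-1) * complex_of_real (max 0 (- Re (f x)))) +
      \<i> * (complex_of_real (max 0 (Im (f x))) + (-1) * complex_of_real (max 0 (- Im (f x)))))"
    using p re im by (intro add cmult L2_space_add L2_space_cmult) auto
  also have "(\<lambda>x. (complex_of_real (max 0 (Re (f x))) + (-1) * complex_of_real (max 0 (- Re (f x)))) +
      \<i> * (complex_of_real (max 0 (Im (f x))) + (-1) * complex_of_real (max 0 (- Im (f x))))) = f"
    by (auto simp: fun_eq_iff complex_eq_iff max_def)
  finally show ?thesis .
qed

section \<open>The kernel and its adjoint on \<open>L\<^sup>2(Q)\<close>\<close>

text \<open>The invariant law \<open>M\<close> also carries the state space, so that null sets and
  the measurability of \<open>K\<close> refer to one measure.\<close>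

locale invariant_kernel = prob_space M for M :: "'a measure" +
  fixes K :: "'a \<Rightarrow> 'a measure"
  assumes kernel[measurable]: "K \<in> M \<rightarrow>\<^sub>M prob_algebra M"
    and invariant: "M \<bind> K = M"
begin

lemma kernel_subprob[measurable]: "K \<in> M \<rightarrow>\<^sub>M subprob_algebra M"
  by (rule measurable_prob_algebraD[OF kernel])

lemma
  assumes "x \<in> space M"
  shows sets_kernel[measurable_cong]: "sets (K x) = sets M"
    and prob_space_kernel: "prob_space (K x)"
  using measurable_space[OF kernel assms] by (auto simp: space_prob_algebra)

lemma measurable_kernel: "x \<in> space M \<Longrightarrow> f \<in> borel_measurable M \<Longrightarrow> f \<in> borel_measurable (K x)"
  using sets_kernel measurable_cong_sets by blast

lemma nn_integral_invariant:
  assumes "f \<in> borel_measurable M"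
  shows "(\<integral>\<^sup>+x. (\<integral>\<^sup>+z. f z \<partial>K x) \<partial>M) = (\<integral>\<^sup>+x. f x \<partial>M)"
  using nn_integral_bind[OF assms kernel_subprob] invariant by simp

text \<open>Invariance prevents \<open>K x\<close> from charging a given null set, for almost every
  \<open>x\<close>; this makes the kernel operator compatible with equality almost
  everywhere.\<close>

lemma AE_invariant:
  assumes "Measurable.pred M P" "AE x in M. P x"
  shows "AE x in M. AE z in K x. P z"
  using AE_bind[OF kernel_subprob assms(1)] assms(2) unfolding invariant by blast

text \<open>Jensen's inequality for the square, obtained as Cauchy-Schwarz against the constant
  1.\<close>

lemma nn_integral_kernel_power2_le:
  assumes x: "x \<in> space M" and f: "f \<in> borel_measurable M"
  shows "(\<integral>\<^sup>+z. f z \<partial>K x)\<^sup>2 \<le> (\<integral>\<^sup>+z. (f z)\<^sup>2 \<partial>K x)"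
proof -
  interpret Kx: prob_space "K x" by (rule prob_space_kernel[OF x])
  show ?thesis
    using Cauchy_Schwarz_nn_integral[OF measurable_kernel[OF x f], of "\<lambda>_. 1"]
    by (simp add: Kx.emeasure_space_1)
qed

text \<open>Invariance makes the iterated integral of the square finite, hence the inner one finite
  almost everywhere. The additivity of the kernel operator needs this, as \<open>f\<close> may fail
  to be integrable under individual \<open>K x\<close>.\<close>

lemma AE_L2_space_kernel:
  assumes f: "f \<in> L2_space M"
  shows "AE x in M. f \<in> L2_space (K x)"
proof -
  have [measurable]: "f \<in> borel_measurable M" using f by (auto simp: L2_space_def)
  have "(\<integral>\<^sup>+x. (\<integral>\<^sup>+z. ennreal ((cmod (f z))\<^sup>2) \<partial>K x) \<partial>M) < \<infinity>"
    using f by (subst nn_integral_invariant) (auto simp: L2_space_iff)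
  then have "AE x in M. (\<integral>\<^sup>+z. ennreal ((cmod (f z))\<^sup>2) \<partial>K x) \<noteq> \<infinity>"
    by (intro nn_integral_PInf_AE) auto
  then show ?thesis
    using AE_space by eventually_elim (auto simp: L2_space_iff less_top measurable_kernel)
qed

lemma integrable_kernel_L2:
  assumes "x \<in> space M" "f \<in> L2_space (K x)"
  shows "integrable (K x) f"
proof -
  interpret Kx: prob_space "K x" by (rule prob_space_kernel[OF assms(1)])
  have "(\<lambda>_. 1) \<in> L2_space (K x)" by (simp add: L2_space_def)
  from L2_integrable_mult[OF assms(2) this] show ?thesis by simp
qed

text \<open>Jensen's inequality under each \<open>K x\<close>, integrated by invariance.\<close>

lemma kernel_operator_contraction: "L2_contraction M (kernel_operator K)"
proof -
  have *: "kernel_operator K f \<in> L2_space M" "L2_norm M (kernel_operator K f) \<le> L2_norm M f"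
    if f: "f \<in> L2_space M" for f
  proof -
    have [measurable]: "f \<in> borel_measurable M" using f by (auto simp: L2_space_def)
    have m: "kernel_operator K f \<in> borel_measurable M"
      unfolding kernel_operator_def by measurable
    have "(\<integral>\<^sup>+x. ennreal ((cmod (kernel_operator K f x))\<^sup>2) \<partial>M) \<le>
        (\<integral>\<^sup>+x. (\<integral>\<^sup>+z. ennreal ((cmod (f z))\<^sup>2) \<partial>K x) \<partial>M)"
    proof (rule nn_integral_mono)
      fix x assume x: "x \<in> space M"
      have "ennreal (cmod (kernel_operator K f x)) \<le> (\<integral>\<^sup>+z. ennreal (cmod (f z)) \<partial>K x)"
      \<comment> \<open>Where \<open>f\<close> is not integrable the integral has the default value
        0, and the bound is trivial.\<close>
      proof (cases "integrable (K x) f")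
        case True
        then show ?thesis
          unfolding kernel_operator_def by (rule integral_norm_bound_ennreal)
      qed (simp add: kernel_operator_def not_integrable_integral_eq)
      then have "(ennreal (cmod (kernel_operator K f x)))\<^sup>2 \<le> (\<integral>\<^sup>+z. ennreal (cmod (f z)) \<partial>K x)\<^sup>2"
        by (intro power_mono) auto
      also have "\<dots> \<le> (\<integral>\<^sup>+z. (ennreal (cmod (f z)))\<^sup>2 \<partial>K x)"
        by (intro nn_integral_kernel_power2_le x) auto
      finally show "ennreal ((cmod (kernel_operator K f x))\<^sup>2) \<le> (\<integral>\<^sup>+z. ennreal ((cmod (f z))\<^sup>2) \<partial>K x)"
        by (simp add: ennreal_power)
    qed
    also have "\<dots> = (\<integral>\<^sup>+x. ennreal ((cmod (f x))\<^sup>2) \<partial>M)"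
      by (intro nn_integral_invariant) auto
    also have "\<dots> = ennreal ((L2_norm M f)\<^sup>2)"
      by (rule ennreal_L2_norm[OF f, symmetric])
    finally show "kernel_operator K f \<in> L2_space M" "L2_norm M (kernel_operator K f) \<le> L2_norm M f"
      using L2_space_norm_leI[OF m L2_norm_nonneg] by auto
  qed
  have "L2_bounded_operator M (kernel_operator K)"
    unfolding L2_bounded_operator_def
  proof (intro conjI ballI allI impI)
    fix f g assume f: "f \<in> L2_space M" and g: "g \<in> L2_space M"
    have [measurable]: "f \<in> borel_measurable M" "g \<in> borel_measurable M"
      using f g by (auto simp: L2_space_def)
    { assume fg: "AE x in M. f x = g x"
      have "AE x in M. AE z in K x. f z = g z"
        by (intro AE_invariant fg) measurable
      then show "AE x in M. kernel_operator K f x = kernel_operator K g x"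
        using AE_space
        by eventually_elim (auto simp: kernel_operator_def intro!: integral_cong_AE measurable_kernel) }
    show "AE x in M. kernel_operator K (\<lambda>z. f z + g z) x = kernel_operator K f x + kernel_operator K g x"
      using AE_L2_space_kernel[OF f] AE_L2_space_kernel[OF g] AE_space
      by eventually_elim (simp add: kernel_operator_def integrable_kernel_L2)
  next
    fix f c assume f: "f \<in> L2_space M"
    show "AE x in M. kernel_operator K (\<lambda>z. c * f z) x = c * kernel_operator K f x"
      by (simp add: kernel_operator_def)
  qed (use * in \<open>auto intro: exI[of _ 1]\<close>)
  then show ?thesis
    using * by (simp add: L2_contraction_def)
qed

text \<open>The adjoint applied to a nonnegative \<open>w\<close> is the density of \<open>w M K\<close> with respect to \<open>M\<close>.\<close>

lemma nonneg_adjoint_ex: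
  assumes [measurable]: "w \<in> borel_measurable M" and w: "(\<integral>\<^sup>+x. (w x)\<^sup>2 \<partial>M) < \<infinity>"
  obtains r :: "'a \<Rightarrow> real" where "r \<in> borel_measurable M" "\<And>x. 0 \<le> r x"
    "(\<integral>\<^sup>+x. (ennreal (r x))\<^sup>2 \<partial>M) < \<infinity>"
    "\<And>\<phi>. \<phi> \<in> borel_measurable M \<Longrightarrow> (\<integral>\<^sup>+x. w x * (\<integral>\<^sup>+z. \<phi> z \<partial>K x) \<partial>M) = (\<integral>\<^sup>+x. ennreal (r x) * \<phi> x \<partial>M)"
proof -
  define \<nu> where "\<nu> = density M w \<bind> K"
  have K': "K \<in> density M w \<rightarrow>\<^sub>M subprob_algebra M"
    using kernel_subprob by simp
  have nu: "(\<integral>\<^sup>+x. \<phi> x \<partial>\<nu>) = (\<integral>\<^sup>+x. w x * (\<integral>\<^sup>+z. \<phi> z \<partial>K x) \<partial>M)"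
    if [measurable]: "\<phi> \<in> borel_measurable M" for \<phi>
    unfolding \<nu>_def by (subst nn_integral_bind[OF that K']) (auto intro!: nn_integral_density)
  have sets_nu: "sets \<nu> = sets M"
    unfolding \<nu>_def using not_empty by (subst sets_bind[of _ _ M]) (auto simp: sets_kernel)
  \<comment> \<open>By invariance a null set has \<open>K x\<close>-mass 0 for almost every
    \<open>x\<close>, so one transition from the density \<open>w\<close> does not charge
    it.\<close>
  have "absolutely_continuous M \<nu>"
    unfolding absolutely_continuous_def
  proof
    fix A assume A: "A \<in> null_sets M"
    then have [measurable]: "A \<in> sets M" by auto
    have "(\<integral>\<^sup>+x. (\<integral>\<^sup>+z. indicator A z \<partial>K x) \<partial>M) = 0"
      using A by (subst nn_integral_invariant) auto
    then have "AE x in M. (\<integral>\<^sup>+z. indicator A z \<partial>K x) = 0"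
      by (subst (asm) nn_integral_0_iff_AE) auto
    then have "(\<integral>\<^sup>+x. w x * (\<integral>\<^sup>+z. indicator A z \<partial>K x) \<partial>M) = (\<integral>\<^sup>+x. 0 \<partial>M)"
      by (intro nn_integral_cong_AE) auto
    then have "emeasure \<nu> A = 0"
      using nu[of "indicator A"] by (simp add: sets_nu)
    then show "A \<in> null_sets \<nu>"
      using sets_nu by (auto simp: null_sets_def)
  qed
  note RN = RN_deriv_nn_integral[OF this sets_nu]
  define r0 where "r0 = RN_deriv M \<nu>"
  have [measurable]: "r0 \<in> borel_measurable M" by (simp add: r0_def)
  have r0: "(\<integral>\<^sup>+x. w x * (\<integral>\<^sup>+z. \<phi> z \<partial>K x) \<partial>M) = (\<integral>\<^sup>+x. r0 x * \<phi> x \<partial>M)"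
    if "\<phi> \<in> borel_measurable M" for \<phi>
    using nu[OF that] RN[OF that] by (simp add: r0_def)
  let ?W = "\<integral>\<^sup>+x. (w x)\<^sup>2 \<partial>M"
  \<comment> \<open>Duality gives \<open>?I\<^sup>2 \<le> ?W * ?I\<close>; cancelling
    \<open>?I\<close> requires it to be finite, hence the truncation at \<open>N\<close>.\<close>
  have trunc: "(\<integral>\<^sup>+x. (min (r0 x) (of_nat N))\<^sup>2 \<partial>M) \<le> ?W" for N :: nat
  proof -
    let ?m = "\<lambda>x. min (r0 x) (of_nat N)"
    let ?I = "\<integral>\<^sup>+x. (?m x)\<^sup>2 \<partial>M"
    have "?I \<le> (\<integral>\<^sup>+x. (of_nat N)\<^sup>2 \<partial>M)"
      by (intro nn_integral_mono power_mono) auto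
    also have "\<dots> < top"
      by (simp add: emeasure_space_1 power_less_top_ennreal of_nat_less_top)
    finally have fin: "?I < top" .
    have "?I \<le> (\<integral>\<^sup>+x. r0 x * ?m x \<partial>M)"
      by (intro nn_integral_mono) (auto simp: power2_eq_square intro!: mult_right_mono)
    also have "\<dots> = (\<integral>\<^sup>+x. w x * (\<integral>\<^sup>+z. ?m z \<partial>K x) \<partial>M)"
      by (rule r0[symmetric]) measurable
    finally have "?I\<^sup>2 \<le> (\<integral>\<^sup>+x. w x * (\<integral>\<^sup>+z. ?m z \<partial>K x) \<partial>M)\<^sup>2"
      by (intro power_mono) auto
    also have "\<dots> \<le> ?W * (\<integral>\<^sup>+x. (\<integral>\<^sup>+z. ?m z \<partial>K x)\<^sup>2 \<partial>M)"
      by (intro Cauchy_Schwarz_nn_integral) auto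
    also have "(\<integral>\<^sup>+x. (\<integral>\<^sup>+z. ?m z \<partial>K x)\<^sup>2 \<partial>M) \<le> (\<integral>\<^sup>+x. (\<integral>\<^sup>+z. (?m z)\<^sup>2 \<partial>K x) \<partial>M)"
      by (intro nn_integral_mono nn_integral_kernel_power2_le) auto
    also have "\<dots> = ?I"
      by (intro nn_integral_invariant) auto
    finally have "?I\<^sup>2 \<le> ?W * ?I"
      by (auto simp: mult_left_mono)
    then have "?I * ?I \<le> ?I * ?W"
      by (simp only: power2_eq_square mult.commute)
    then show "?I \<le> ?W"
      using fin by (cases "?I = 0") (simp_all add: ennreal_mult_le_mult_iff)
  qed
  have "(\<integral>\<^sup>+x. (r0 x)\<^sup>2 \<partial>M) = (\<integral>\<^sup>+x. liminf (\<lambda>N. (min (r0 x) (of_nat N))\<^sup>2) \<partial>M)"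
  proof (intro nn_integral_cong)
    fix x
    have "(\<lambda>N. min (r0 x) (of_nat N)) \<longlonglongrightarrow> min (r0 x) top"
      by (intro tendsto_min tendsto_const of_nat_tendsto_top_ennreal)
    then have "(\<lambda>N. min (r0 x) (of_nat N) * min (r0 x) (of_nat N)) \<longlonglongrightarrow> r0 x * r0 x"
      by (intro tendsto_mult_ennreal) auto
    then show "(r0 x)\<^sup>2 = liminf (\<lambda>N. (min (r0 x) (of_nat N))\<^sup>2)"
      unfolding power2_eq_square by (rule lim_imp_Liminf[symmetric, rotated]) simp
  qed
  \<comment> \<open>Fatou's lemma removes the truncation, since the bound \<open>?W\<close> does not
    depend on \<open>N\<close>.\<close>
  also have "\<dots> \<le> liminf (\<lambda>N. \<integral>\<^sup>+x. (min (r0 x) (of_nat N))\<^sup>2 \<partial>M)"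
    by (intro nn_integral_liminf) auto
  also have "\<dots> \<le> liminf (\<lambda>N::nat. ?W)"
    by (intro Liminf_mono always_eventually allI trunc)
  also have "\<dots> = ?W"
    by (simp add: Liminf_const)
  finally have r0_fin: "(\<integral>\<^sup>+x. (r0 x)\<^sup>2 \<partial>M) < \<infinity>"
    using w by auto
  then have "AE x in M. (r0 x)\<^sup>2 \<noteq> \<infinity>"
    by (intro nn_integral_PInf_AE) auto
  \<comment> \<open>Square integrability makes the density finite almost everywhere, so a real
    function can represent it.\<close>
  then have r0_enn: "AE x in M. ennreal (enn2real (r0 x)) = r0 x"
    by eventually_elim (auto simp: less_top power2_eq_square ennreal_mult_eq_top_iff)
  show ?thesis
  proof (rule that[of "\<lambda>x. enn2real (r0 x)"])
    have "(\<integral>\<^sup>+x. (ennreal (enn2real (r0 x)))\<^sup>2 \<partial>M) = (\<integral>\<^sup>+x. (r0 x)\<^sup>2 \<partial>M)"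
      using r0_enn by (intro nn_integral_cong_AE) auto
    with r0_fin show "(\<integral>\<^sup>+x. (ennreal (enn2real (r0 x)))\<^sup>2 \<partial>M) < \<infinity>" by simp
    fix \<phi> :: "'a \<Rightarrow> ennreal" assume "\<phi> \<in> borel_measurable M"
    have "(\<integral>\<^sup>+x. ennreal (enn2real (r0 x)) * \<phi> x \<partial>M) = (\<integral>\<^sup>+x. r0 x * \<phi> x \<partial>M)"
      using r0_enn by (intro nn_integral_cong_AE) auto
    with r0[OF \<open>\<phi> \<in> borel_measurable M\<close>]
    show "(\<integral>\<^sup>+x. w x * (\<integral>\<^sup>+z. \<phi> z \<partial>K x) \<partial>M) = (\<integral>\<^sup>+x. ennreal (enn2real (r0 x)) * \<phi> x \<partial>M)"
      by simp
  qed auto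
qed

text \<open>The identity is linear in \<open>f\<close> and conjugate linear in \<open>g\<close>, so
  \<open>L2_space_induct\<close>, used first for \<open>g\<close> and then for \<open>f\<close>,
  leaves nonnegative functions, where the density is the adjoint.\<close>

lemma L2_adjoint_ex:
  assumes "g \<in> L2_space M"
  shows "\<exists>r\<in>L2_space M. \<forall>f\<in>L2_space M. L2_inner M (kernel_operator K f) g = L2_inner M f r"
  using assms
proof (induction g rule: L2_space_induct)
  case (nonneg w)
  have KD: "L2_bounded_operator M (kernel_operator K)"
    using kernel_operator_contraction by (simp add: L2_contraction_def)
  note D = L2_bounded_operatorD[OF KD]
  have "(\<lambda>x. Re (complex_of_real (w x))) \<in> borel_measurable M"
    by (rule measurable_compose[OF L2_space_measurable[OF nonneg(1)]]) simp
  then have w[measurable]: "w \<in> borel_measurable M" by simp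
  have "(\<integral>\<^sup>+x. (ennreal (w x))\<^sup>2 \<partial>M) < \<infinity>"
    using nonneg by (simp add: L2_space_iff ennreal_power)
  moreover have "(\<lambda>x. ennreal (w x)) \<in> borel_measurable M"
    by measurable
  ultimately obtain r :: "'a \<Rightarrow> real"
    where r[measurable]: "r \<in> borel_measurable M" and r0: "\<And>x. 0 \<le> r x"
    and r2: "(\<integral>\<^sup>+x. (ennreal (r x))\<^sup>2 \<partial>M) < \<infinity>"
    and adj: "\<And>\<phi>. \<phi> \<in> borel_measurable M \<Longrightarrow>
      (\<integral>\<^sup>+x. ennreal (w x) * (\<integral>\<^sup>+z. \<phi> z \<partial>K x) \<partial>M) = (\<integral>\<^sup>+x. ennreal (r x) * \<phi> x \<partial>M)"
    using nonneg_adjoint_ex[of "\<lambda>x. ennreal (w x)"] by blast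
  have rL2: "(\<lambda>x. complex_of_real (r x)) \<in> L2_space M"
    using r2 r0 by (simp add: L2_space_iff ennreal_power)
  have "(\<integral>x. kernel_operator K f x * complex_of_real (w x) \<partial>M) = (\<integral>x. f x * complex_of_real (r x) \<partial>M)"
    if "f \<in> L2_space M" for f
    using that
  proof (induction f rule: L2_space_induct)
    case (nonneg \<phi>)
    have "(\<lambda>x. Re (complex_of_real (\<phi> x))) \<in> borel_measurable M"
      by (rule measurable_compose[OF L2_space_measurable[OF nonneg(1)]]) simp
    then have phi[measurable]: "\<phi> \<in> borel_measurable M" by simp
    \<comment> \<open>The duality is known for nonnegative extended integrals; the Bochner integrals
      are moved there and back, using that \<phi> is integrable under \<open>K x\<close> for almost
      every \<open>x\<close>.\<close>
    have "(\<integral>x. (\<integral>z. \<phi> z \<partial>K x) * w x \<partial>M) = enn2real (\<integral>\<^sup>+x. ennreal ((\<integral>z. \<phi> z \<partial>K x) * w x) \<partial>M)"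
      using \<open>\<And>x. 0 \<le> w x\<close> nonneg by (intro integral_eq_nn_integral) (auto intro!: mult_nonneg_nonneg integral_nonneg)
    also have "(\<integral>\<^sup>+x. ennreal ((\<integral>z. \<phi> z \<partial>K x) * w x) \<partial>M) = (\<integral>\<^sup>+x. ennreal (w x) * (\<integral>\<^sup>+z. ennreal (\<phi> z) \<partial>K x) \<partial>M)"
    proof (rule nn_integral_cong_AE)
      show "AE x in M. ennreal ((\<integral>z. \<phi> z \<partial>K x) * w x) = ennreal (w x) * (\<integral>\<^sup>+z. ennreal (\<phi> z) \<partial>K x)"
        using AE_L2_space_kernel[OF nonneg(1)] AE_space
      proof eventually_elim
        case (elim x)
        then have "integrable (K x) \<phi>"
          using integrable_kernel_L2[OF elim(2,1)] by (simp only: complex_of_real_integrable_eq)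
        then have "(\<integral>\<^sup>+z. ennreal (\<phi> z) \<partial>K x) = ennreal (\<integral>z. \<phi> z \<partial>K x)"
          using nonneg by (intro nn_integral_eq_integral) auto
        then show ?case
          using \<open>\<And>x. 0 \<le> w x\<close> nonneg by (simp add: ennreal_mult'' mult.commute)
      qed
    qed
    also have "\<dots> = (\<integral>\<^sup>+x. ennreal (r x) * ennreal (\<phi> x) \<partial>M)"
      by (rule adj) measurable
    also have "enn2real \<dots> = (\<integral>x. \<phi> x * r x \<partial>M)"
      using nonneg r0 by (subst integral_eq_nn_integral) (auto simp: ennreal_mult'' mult.commute)
    finally have "complex_of_real (\<integral>x. (\<integral>z. \<phi> z \<partial>K x) * w x \<partial>M) = complex_of_real (\<integral>x. \<phi> x * r x \<partial>M)"
      by simp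
    then show ?case
      by (simp add: kernel_operator_def flip: integral_complex_of_real)
  next
    case (add f g)
    have "(\<integral>x. kernel_operator K (\<lambda>x. f x + g x) x * complex_of_real (w x) \<partial>M) =
        (\<integral>x. (kernel_operator K f x * complex_of_real (w x) + kernel_operator K g x * complex_of_real (w x)) \<partial>M)"
      using D(3)[OF add(1,2)] add D(1) D(1)[OF L2_space_add[OF add(1,2)]]
      by (intro integral_cong_AE) (auto simp: distrib_right dest!: L2_space_measurable)
    also have "\<dots> = (\<integral>x. (f x + g x) * complex_of_real (r x) \<partial>M)"
      using add L2_integrable_mult[OF D(1) nonneg(1)] L2_integrable_mult[OF _ rL2]
      by (simp add: distrib_right)
    finally show ?case .
  next
    case (cmult c f)
    then show ?case by (simp add: kernel_operator_def mult.assoc)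
  qed
  then show ?case
    by (intro bexI[OF _ rL2]) (simp add: L2_inner_def)
next
  case (add f g)
  then obtain r s where "r \<in> L2_space M" "s \<in> L2_space M"
    "\<forall>h\<in>L2_space M. L2_inner M (kernel_operator K h) f = L2_inner M h r"
    "\<forall>h\<in>L2_space M. L2_inner M (kernel_operator K h) g = L2_inner M h s"
    by blast
  moreover have "kernel_operator K h \<in> L2_space M" if "h \<in> L2_space M" for h
    using kernel_operator_contraction L2_bounded_operatorD(1) that by (auto simp: L2_contraction_def)
  ultimately show ?case
    using add(1,2) by (intro bexI[of _ "\<lambda>x. r x + s x"]) (auto simp: L2_inner_add_right intro: L2_space_add)
next
  case (cmult c g)
  then obtain r where "r \<in> L2_space M"
    "\<forall>h\<in>L2_space M. L2_inner M (kernel_operator K h) g = L2_inner M h r"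
    by blast
  then show ?case
    by (intro bexI[of _ "\<lambda>x. c * r x"]) (auto simp: L2_inner_cmult_right intro: L2_space_cmult)
qed

text \<open>Some adjoint exists, so the one picked by \<open>SOME\<close> has the defining property,
  and this property forces the contraction bound.\<close>

lemma L2_adjoint_contraction: "L2_contraction M (L2_adjoint M (kernel_operator K))"
proof -
  obtain T' where T': "\<And>g. g \<in> L2_space M \<Longrightarrow> T' g \<in> L2_space M"
    "\<And>f g. g \<in> L2_space M \<Longrightarrow> f \<in> L2_space M \<Longrightarrow> L2_inner M (kernel_operator K f) g = L2_inner M f (T' g)"
    using L2_adjoint_ex by metis
  then have "L2_bounded_operator M T'"
    using L2_contraction_adjoint[OF kernel_operator_contraction, of T'] by (simp add: L2_contraction_def)
  moreover define adjoint where "adjoint U \<longleftrightarrow> L2_bounded_operator M U \<and>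
     (\<forall>f\<in>L2_space M. \<forall>g\<in>L2_space M. L2_inner M (kernel_operator K f) g = L2_inner M f (U g))" for U
  ultimately have "adjoint T'"
    using T' by simp
  then have "adjoint (L2_adjoint M (kernel_operator K))"
    unfolding L2_adjoint_def adjoint_def[symmetric] by (rule someI[of adjoint])
  then show ?thesis
    by (intro L2_contraction_adjoint[OF kernel_operator_contraction]) (auto simp: adjoint_def dest: L2_bounded_operatorD(1))
qed

text \<open>The term for \<open>k = 1\<close> is nonnegative and lies below the supremum, once the
  family is known to be bounded above.\<close>

lemma pseudo_spectral_gap_nonneg: "0 \<le> pseudo_spectral_gap M K"
proof -
  let ?g = "\<lambda>k. spectral_gap M ((L2_adjoint M (kernel_operator K) ^^ k) \<circ> (kernel_operator K ^^ k)) / real k"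
  have c: "L2_contraction M ((L2_adjoint M (kernel_operator K) ^^ k) \<circ> (kernel_operator K ^^ k))" for k
    by (intro L2_contraction_comp L2_contraction_funpow L2_adjoint_contraction kernel_operator_contraction)
  have "?g k \<le> 2" if "k \<in> {1..}" for k
    using spectral_gap_contraction(2)[OF c[of k]] that
    by (intro divide_le_eq[THEN iffD2]) (auto intro: order.trans)
  then have "bdd_above (?g ` {1..})"
    by (intro bdd_aboveI[of _ 2]) auto
  then have "?g 1 \<le> pseudo_spectral_gap M K"
    unfolding pseudo_spectral_gap_def by (intro cSUP_upper) auto
  then show ?thesis
    using spectral_gap_contraction(1)[OF c[of 1]] by simp
qed

end

section \<open>Total variation and mixing\<close>

lemma tv_dist_bounds:
  assumes "prob_space P" "prob_space P'"
  shows tv_dist_ge: "A \<in> sets P \<Longrightarrow> \<bar>measure P A - measure P' A\<bar> \<le> tv_dist P P'"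
    and tv_dist_le_1: "tv_dist P P' \<le> 1"
proof -
  have *: "\<bar>measure P A - measure P' A\<bar> \<le> 1" for A
    using prob_space.prob_le_1[OF assms(1), of A] prob_space.prob_le_1[OF assms(2), of A]
      measure_nonneg[of P A] measure_nonneg[of P' A] by linarith
  show "A \<in> sets P \<Longrightarrow> \<bar>measure P A - measure P' A\<bar> \<le> tv_dist P P'"
    unfolding tv_dist_def using * by (intro cSUP_upper bdd_aboveI[of _ 1]) auto
  show "tv_dist P P' \<le> 1"
    unfolding tv_dist_def using * sets.top[of P] by (intro cSUP_least) auto
qed

text \<open>Up to an error \<open>1 / n\<close>, \<open>f\<close> is the average of the indicators of \<open>f \<ge> i / n\<close>.\<close>

lemma tv_dist_integral_01:
  fixes f :: "'a \<Rightarrow> real"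
  assumes P: "prob_space P" and P': "prob_space P'" and sets: "sets P' = sets P"
    and f[measurable]: "f \<in> borel_measurable P"
    and f01: "\<And>x. x \<in> space P \<Longrightarrow> 0 \<le> f x \<and> f x \<le> 1"
  shows "\<bar>(\<integral>x. f x \<partial>P) - (\<integral>x. f x \<partial>P')\<bar> \<le> tv_dist P P'"
proof -
  interpret P: prob_space P by fact
  interpret P': prob_space P' by fact
  have sp: "space P' = space P"
    using sets by (rule sets_eq_imp_space_eq)
  have f'[measurable]: "f \<in> borel_measurable P'"
    using f sets measurable_cong_sets by blast
  define A where "A n i = {x\<in>space P. real i \<le> real n * f x}" for n i :: nat
  have A[measurable]: "A n i \<in> sets P" for n i
    unfolding A_def by measurable
  have A'[measurable]: "A n i \<in> sets P'" for n i
    using A sets by simp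
  define fn where "fn n x = (\<Sum>i=1..n. indicator (A n i) x) / real n" for n x
  \<comment> \<open>The level sets containing \<open>x\<close> are those with index up to the floor
    of \<open>n * f x\<close>, so the average rounds \<open>f\<close> down to a multiple of
    \<open>1 / n\<close>.\<close>
  have fn: "fn n x = of_int \<lfloor>real n * f x\<rfloor> / real n" if x: "x \<in> space P" for n x
  proof -
    have "(\<Sum>i=1..n. indicator (A n i) x) = (\<Sum>i=1..n. if i \<le> nat \<lfloor>real n * f x\<rfloor> then 1 else 0 :: real)"
      using x f01[OF x] by (intro sum.cong refl) (auto simp: A_def indicator_def le_nat_floor nat_le_iff le_floor_iff le_nat_iff)
    also have "\<dots> = real (card {i\<in>{1..n}. i \<le> nat \<lfloor>real n * f x\<rfloor>})"
      by (simp add: sum.If_cases Int_def)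
    finally have card: "(\<Sum>i=1..n. indicator (A n i) x) = real (card {i\<in>{1..n}. i \<le> nat \<lfloor>real n * f x\<rfloor>})" .
    have "real n * f x \<le> real n * 1"
      using f01[OF x] by (intro mult_left_mono) auto
    then have "nat \<lfloor>real n * f x\<rfloor> \<le> n"
      by linarith
    then have "{i\<in>{1..n}. i \<le> nat \<lfloor>real n * f x\<rfloor>} = {1..nat \<lfloor>real n * f x\<rfloor>}"
      by auto
    then show ?thesis
      using card f01[OF x] by (simp add: fn_def)
  qed
  have close: "f x - 1 / real n \<le> fn n x \<and> fn n x \<le> f x" if x: "x \<in> space P" and n: "0 < n" for n x
  proof -
    have "real n * f x - 1 \<le> of_int \<lfloor>real n * f x\<rfloor>" "of_int \<lfloor>real n * f x\<rfloor> \<le> real n * f x"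
      by linarith+
    then have "(real n * f x - 1) / real n \<le> fn n x" "fn n x \<le> real n * f x / real n"
      unfolding fn[OF x] by (intro divide_right_mono; simp)+
    then show ?thesis
      using n by (simp add: diff_divide_distrib)
  qed
  have int_f: "integrable P f" "integrable P' f"
    using f01 sp by (auto intro!: P.integrable_const_bound[where B=1] P'.integrable_const_bound[where B=1])
  have est: "\<bar>(\<integral>x. f x \<partial>P) - (\<integral>x. f x \<partial>P')\<bar> \<le> tv_dist P P' + 1 / real n" if n: "0 < n" for n
  proof -
    have int_fn: "integrable P (fn n)" "integrable P' (fn n)"
      unfolding fn_def[abs_def] by (auto intro!: integrable_real_indicator simp: P.emeasure_eq_measure P'.emeasure_eq_measure)
    have avg: "(\<integral>x. fn n x \<partial>P) = (\<Sum>i=1..n. measure P (A n i)) / real n"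
      "(\<integral>x. fn n x \<partial>P') = (\<Sum>i=1..n. measure P' (A n i)) / real n"
      unfolding fn_def by (simp_all add: P.emeasure_eq_measure P'.emeasure_eq_measure integrable_real_indicator)
    have "\<bar>(\<Sum>i=1..n. measure P (A n i)) - (\<Sum>i=1..n. measure P' (A n i))\<bar> \<le> (\<Sum>i=1..n. tv_dist P P')"
      unfolding sum_subtractf[symmetric] by (intro order.trans[OF sum_abs] sum_mono tv_dist_ge[OF P P' A])
    then have 1: "\<bar>(\<integral>x. fn n x \<partial>P) - (\<integral>x. fn n x \<partial>P')\<bar> \<le> tv_dist P P'"
      unfolding avg diff_divide_distrib[symmetric] using n by (simp add: field_simps)
    have "(\<integral>x. f x - 1 / real n \<partial>P) \<le> (\<integral>x. fn n x \<partial>P)" "(\<integral>x. fn n x \<partial>P) \<le> (\<integral>x. f x \<partial>P)"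
      "(\<integral>x. f x - 1 / real n \<partial>P') \<le> (\<integral>x. fn n x \<partial>P')" "(\<integral>x. fn n x \<partial>P') \<le> (\<integral>x. f x \<partial>P')"
      by (intro integral_mono; use int_f int_fn n close sp in auto)+
    with 1 show ?thesis
      using int_f by (simp add: P.prob_space P'.prob_space)
  qed
  have "(\<lambda>n. tv_dist P P' + 1 / real n) \<longlonglongrightarrow> tv_dist P P' + 0"
    by (intro tendsto_intros lim_1_over_n)
  then show ?thesis
    using est by (intro LIMSEQ_le_const) (auto intro: exI[of _ 1])
qed

text \<open>Rescale to \<open>(f + c) / (2 * c)\<close>, which takes values in [0, 1]; the factor
  \<open>2 * c\<close> bounds the width of the range of \<open>f\<close>. The case
  \<open>c = 0\<close> is separate because of the division.\<close>

lemma tv_dist_integral: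
  fixes f :: "'a \<Rightarrow> real"
  assumes P: "prob_space P" and P': "prob_space P'" and sets: "sets P' = sets P"
    and f[measurable]: "f \<in> borel_measurable P"
    and f_le: "\<And>x. x \<in> space P \<Longrightarrow> \<bar>f x\<bar> \<le> c"
  shows "\<bar>(\<integral>x. f x \<partial>P) - (\<integral>x. f x \<partial>P')\<bar> \<le> 2 * c * tv_dist P P'"
proof -
  interpret P: prob_space P by fact
  interpret P': prob_space P' by fact
  have sp: "space P' = space P"
    using sets by (rule sets_eq_imp_space_eq)
  have f'[measurable]: "f \<in> borel_measurable P'"
    using f sets measurable_cong_sets by blast
  obtain x0 where "x0 \<in> space P" using P.not_empty by blast
  then have c0: "0 \<le> c" using f_le[of x0] by linarith
  have int_f: "integrable P f" "integrable P' f"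
    using f_le sp by (auto intro!: P.integrable_const_bound[where B=c] P'.integrable_const_bound[where B=c])
  show ?thesis
  proof (cases "c = 0")
    case True
    then have "(\<integral>x. f x \<partial>P) = (\<integral>x. 0 \<partial>P)" "(\<integral>x. f x \<partial>P') = (\<integral>x. 0 \<partial>P')"
      using f_le sp by (intro Bochner_Integration.integral_cong; fastforce)+
    with True show ?thesis by simp
  next
    case False
    have "\<bar>(\<integral>x. (f x + c) / (2 * c) \<partial>P) - (\<integral>x. (f x + c) / (2 * c) \<partial>P')\<bar> \<le> tv_dist P P'"
    proof (rule tv_dist_integral_01[OF P P' sets])
      fix x assume "x \<in> space P"
      from f_le[OF this] False c0 show "0 \<le> (f x + c) / (2 * c) \<and> (f x + c) / (2 * c) \<le> 1"
        by (auto simp: field_simps)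
    qed measurable
    then have "\<bar>((\<integral>x. f x \<partial>P) - (\<integral>x. f x \<partial>P')) / (2 * c)\<bar> \<le> tv_dist P P'"
      using int_f by (simp add: P.prob_space P'.prob_space diff_divide_distrib add_divide_distrib)
    then show ?thesis
      using False c0 by (simp add: abs_divide field_simps)
  qed
qed

text \<open>Each block of \<open>t\<close> consecutive indices carries one power of 1/2, so the sum
  is at most \<open>t\<close> times the geometric series. This is the origin of the factor 2 in the
  bound on the solution of the Poisson equation.\<close>

lemma sum_half_div_le:
  assumes "1 \<le> (t::nat)"
  shows "(\<Sum>k<n. (1 / 2 :: real) ^ (k div t)) \<le> 2 * real t"
proof -
  have block: "(\<Sum>k<J * t. (1 / 2 :: real) ^ (k div t)) = real t * (\<Sum>j<J. (1 / 2) ^ j)" for J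
  proof -
    have "(\<Sum>k<J * t. (1 / 2 :: real) ^ (k div t)) = (\<Sum>j<J. \<Sum>k=j * t..<j * t + t. (1 / 2) ^ (k div t))"
      by (rule sum.nat_group[symmetric])
    also have "\<dots> = (\<Sum>j<J. \<Sum>k=j * t..<j * t + t. (1 / 2) ^ j)"
    proof (intro sum.cong refl)
      fix j k assume "k \<in> {j * t..<j * t + t}"
      then have "k div t = j"
        by (intro div_nat_eqI) (auto simp: mult.commute)
      then show "(1 / 2 :: real) ^ (k div t) = (1 / 2) ^ j" by simp
    qed
    finally show ?thesis
      by (simp add: sum_distrib_left)
  qed
  \<comment> \<open>Extending the range to a multiple of \<open>t\<close> completes the last
    block.\<close>
  have "n \<le> n * t" using assms by simp
  then have "(\<Sum>k<n. (1 / 2 :: real) ^ (k div t)) \<le> (\<Sum>k<n * t. (1 / 2 :: real) ^ (k div t))"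
    by (intro sum_mono2) auto
  also have "\<dots> \<le> real t * 2"
    unfolding block by (intro mult_left_mono) (auto simp: sum_gp_strict)
  finally show ?thesis by simp
qed

text \<open>The real counterpart of \<open>kernel_operator\<close>, applied to bounded functions:
  the estimates below hold at every state and not just almost everywhere, as a chain started from a
  prescribed state requires.\<close>

definition kernel_expectation :: "('a \<Rightarrow> 'a measure) \<Rightarrow> ('a \<Rightarrow> real) \<Rightarrow> 'a \<Rightarrow> real" where
  "kernel_expectation K f x = (\<integral>z. f z \<partial>K x)"

section \<open>Uniformly ergodic kernels: invariance, decay of iterates and the Poisson
  equation\<close>

locale ergodic_kernel = prob_space Q for S :: "'a measure" and K and Q :: "'a measure" +
  assumes K[measurable]: "K \<in> S \<rightarrow>\<^sub>M prob_algebra S"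
    and sets_Q[measurable_cong]: "sets Q = sets S"
    and ergodic: "uniformly_ergodic S K Q"
begin

lemma space_Q: "space Q = space S"
  using sets_Q by (rule sets_eq_imp_space_eq)

lemma K_subprob[measurable]: "K \<in> S \<rightarrow>\<^sub>M subprob_algebra S"
  by (rule measurable_prob_algebraD[OF K])

lemma
  assumes "x \<in> space S"
  shows sets_K: "sets (K x) = sets S" and space_K: "space (K x) = space S"
    and prob_space_K: "prob_space (K x)"
  using measurable_space[OF K assms] by (auto simp: space_prob_algebra dest: sets_eq_imp_space_eq)

lemma measurable_K: "x \<in> space S \<Longrightarrow> f \<in> borel_measurable S \<Longrightarrow> f \<in> borel_measurable (K x)"
  using sets_K measurable_cong_sets by blast

lemma integrable_K:
  fixes f :: "'a \<Rightarrow> real"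
  assumes "x \<in> space S" "f \<in> borel_measurable S" "\<And>z. z \<in> space S \<Longrightarrow> \<bar>f z\<bar> \<le> c"
  shows "integrable (K x) f"
proof -
  interpret Kx: prob_space "K x" by (rule prob_space_K[OF assms(1)])
  show ?thesis
    using assms measurable_K[OF assms(1,2)] space_K[OF assms(1)]
    by (intro Kx.integrable_const_bound[where B=c]) auto
qed

lemma kernel_expectation_measurable[measurable]:
  "f \<in> borel_measurable S \<Longrightarrow> kernel_expectation K f \<in> borel_measurable S"
  unfolding kernel_expectation_def[abs_def]
  by (rule measurable_compose[OF K_subprob integral_measurable_subprob_algebra])

lemma kernel_expectation_bound:
  assumes "x \<in> space S" "f \<in> borel_measurable S" "\<And>z. z \<in> space S \<Longrightarrow> \<bar>f z\<bar> \<le> c"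
  shows "\<bar>kernel_expectation K f x\<bar> \<le> c"
proof -
  interpret Kx: prob_space "K x" by (rule prob_space_K[OF assms(1)])
  have "\<bar>kernel_expectation K f x\<bar> \<le> (\<integral>z. \<bar>f z\<bar> \<partial>K x)"
    unfolding kernel_expectation_def using integral_norm_bound[of "K x" f] by simp
  also have "\<dots> \<le> (\<integral>z. c \<partial>K x)"
    using assms integrable_K[OF assms] by (intro integral_mono) (auto simp: space_K)
  finally show ?thesis by (simp add: Kx.prob_space)
qed

lemma kernel_expectation_funpow_measurable[measurable]:
  "f \<in> borel_measurable S \<Longrightarrow> (kernel_expectation K ^^ k) f \<in> borel_measurable S"
  by (induction k) auto

lemma kernel_expectation_funpow_bound:
  assumes "f \<in> borel_measurable S" "\<And>z. z \<in> space S \<Longrightarrow> \<bar>f z\<bar> \<le> c" "x \<in> space S"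
  shows "\<bar>(kernel_expectation K ^^ k) f x\<bar> \<le> c"
  using assms(3)
  by (induction k arbitrary: x) (auto intro!: kernel_expectation_bound kernel_expectation_funpow_measurable assms(1,2))

lemma kernel_pow_in_prob_algebra:
  assumes "x \<in> space S"
  shows "kernel_pow S K t x \<in> space (prob_algebra S)"
proof (induction t)
  case 0
  then show ?case
    using measurable_space[OF measurable_return_prob_space assms] by (simp add: kernel_pow_def)
next
  case (Suc t)
  then show ?case
    using prob_space_bind'[OF Suc K] sets_bind'[OF Suc K] by (simp add: kernel_pow_def space_prob_algebra)
qed

lemma
  assumes "x \<in> space S"
  shows sets_kernel_pow: "sets (kernel_pow S K t x) = sets S"
    and space_kernel_pow: "space (kernel_pow S K t x) = space S"
    and prob_space_kernel_pow: "prob_space (kernel_pow S K t x)"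
  using kernel_pow_in_prob_algebra[OF assms, of t]
  by (auto simp: space_prob_algebra dest: sets_eq_imp_space_eq)

text \<open>Duality between iterating on measures and on functions. The induction generalizes over
  \<open>f\<close>, because the last transition is absorbed into the integrand.\<close>

lemma integral_kernel_pow:
  assumes x: "x \<in> space S" and f: "f \<in> borel_measurable S" "\<And>z. z \<in> space S \<Longrightarrow> \<bar>f z\<bar> \<le> c"
  shows "(\<integral>z. f z \<partial>kernel_pow S K t x) = (kernel_expectation K ^^ t) f x"
  using f
proof (induction t arbitrary: f)
  case 0
  then show ?case
    using x by (simp add: kernel_pow_def integral_return)
next
  case (Suc t)
  let ?N = "kernel_pow S K t x"
  interpret N: prob_space ?N by (rule prob_space_kernel_pow[OF x])
  have KN: "K \<in> ?N \<rightarrow>\<^sub>M subprob_algebra S"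
    using K_subprob sets_kernel_pow[OF x, of t] measurable_cong_sets by blast
  have "(\<integral>z. f z \<partial>kernel_pow S K (Suc t) x) = (\<integral>z. f z \<partial>(?N \<bind> K))"
    by (simp add: kernel_pow_def)
  also have "\<dots> = (\<integral>z. kernel_expectation K f z \<partial>?N)"
    unfolding kernel_expectation_def using Suc.prems
    by (intro integral_bind[where K=S and B=c and B'=1] KN)
      (auto simp: prob_space.emeasure_space_1 prob_space_K space_kernel_pow[OF x] N.finite_measure_axioms)
  also have "\<dots> = (kernel_expectation K ^^ t) (kernel_expectation K f) x"
    using Suc.prems by (intro Suc.IH kernel_expectation_bound) auto
  finally show ?case
    by (simp add: funpow_swap1)
qed

lemma tv_dist_kernel_pow_le:
  assumes "x \<in> space S"
  shows "tv_dist (kernel_pow S K t x) Q \<le> (SUP x\<in>space S. tv_dist (kernel_pow S K t x) Q)"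
  using assms tv_dist_le_1[OF prob_space_kernel_pow prob_space_axioms]
  by (intro cSUP_upper bdd_aboveI[of _ 1]) auto

lemma funpow_tendsto:
  assumes x: "x \<in> space S" and f: "f \<in> borel_measurable S" "\<And>z. z \<in> space S \<Longrightarrow> \<bar>f z\<bar> \<le> c"
  shows "(\<lambda>t. (kernel_expectation K ^^ t) f x) \<longlonglongrightarrow> (\<integral>z. f z \<partial>Q)"
proof -
  obtain C \<rho> where C: "0 < C" "0 < \<rho>" "\<rho> < 1"
    "\<And>t. (SUP x\<in>space S. tv_dist (kernel_pow S K t x) Q) \<le> C * \<rho> ^ t"
    using ergodic unfolding uniformly_ergodic_def by blast
  have c0: "0 \<le> c" using f(2)[OF x] by linarith
  have *: "\<bar>(kernel_expectation K ^^ t) f x - (\<integral>z. f z \<partial>Q)\<bar> \<le> 2 * c * (C * \<rho> ^ t)" for t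
  proof -
    have "\<bar>(kernel_expectation K ^^ t) f x - (\<integral>z. f z \<partial>Q)\<bar> \<le> 2 * c * tv_dist (kernel_pow S K t x) Q"
      using f integral_kernel_pow[OF x f, of t, symmetric] sets_kernel_pow[OF x, of t] space_kernel_pow[OF x, of t]
      by (auto intro!: tv_dist_integral prob_space_kernel_pow x prob_space_axioms simp: sets_Q cong: measurable_cong_sets)
    also have "\<dots> \<le> 2 * c * (C * \<rho> ^ t)"
      using tv_dist_kernel_pow_le[OF x, of t] C(4)[of t] c0 by (intro mult_left_mono) auto
    finally show ?thesis .
  qed
  have "(\<lambda>t. 2 * c * (C * \<rho> ^ t)) \<longlonglongrightarrow> 2 * c * (C * 0)"
    using C by (intro tendsto_intros LIMSEQ_power_zero) auto
  then have "(\<lambda>t. 2 * c * (C * \<rho> ^ t)) \<longlonglongrightarrow> 0"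
    by simp
  then have "(\<lambda>t. (kernel_expectation K ^^ t) f x - (\<integral>z. f z \<partial>Q)) \<longlonglongrightarrow> 0"
    by (rule Lim_null_comparison[rotated]) (simp add: * always_eventually)
  then show ?thesis
    by (simp add: LIM_zero_iff)
qed

text \<open>The iterates of \<open>kernel_expectation K f\<close> are those of \<open>f\<close>
  shifted by one, so their limits, the two integrals under \<open>Q\<close>, coincide.\<close>

lemma integral_kernel_expectation:
  assumes f: "f \<in> borel_measurable S" "\<And>z. z \<in> space S \<Longrightarrow> \<bar>f z\<bar> \<le> c"
  shows "(\<integral>z. kernel_expectation K f z \<partial>Q) = (\<integral>z. f z \<partial>Q)"
proof -
  obtain x where x: "x \<in> space S" using not_empty space_Q by auto
  have "(\<lambda>t. (kernel_expectation K ^^ t) (kernel_expectation K f) x) \<longlonglongrightarrow> (\<integral>z. kernel_expectation K f z \<partial>Q)"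
    by (intro funpow_tendsto[where c=c] x kernel_expectation_bound kernel_expectation_measurable f)
  moreover have "(\<lambda>t. (kernel_expectation K ^^ Suc t) f x) \<longlonglongrightarrow> (\<integral>z. f z \<partial>Q)"
    by (intro LIMSEQ_Suc funpow_tendsto[where c=c] x f)
  ultimately show ?thesis
    by (simp add: funpow_swap1 LIMSEQ_unique)
qed

text \<open>Testing invariance on indicators gives equality of measures and makes the L2 theory
  available for \<open>Q\<close>.\<close>

sublocale invariant_kernel Q K
proof
  show "K \<in> Q \<rightarrow>\<^sub>M prob_algebra Q"
    using K sets_Q measurable_cong_sets by (simp add: prob_algebra_def subprob_algebra_cong[OF sets_Q])
  have KQ: "K \<in> Q \<rightarrow>\<^sub>M subprob_algebra S"
    using K_subprob sets_Q measurable_cong_sets by blast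
  have QP: "Q \<in> space (prob_algebra S)"
    using sets_Q prob_space_axioms by (simp add: space_prob_algebra)
  interpret QK: prob_space "Q \<bind> K" by (rule prob_space_bind'[OF QP K])
  show "Q \<bind> K = Q"
  proof (rule measure_eqI)
    show "sets (Q \<bind> K) = sets Q"
      using sets_bind'[OF QP K] sets_Q by simp
    fix A assume "A \<in> sets (Q \<bind> K)"
    then have A[measurable]: "A \<in> sets S"
      using sets_bind'[OF QP K] by simp
    have "measure (Q \<bind> K) A = (\<integral>x. measure (K x) A \<partial>Q)"
      by (rule measure_bind[OF KQ A])
    also have "\<dots> = (\<integral>x. kernel_expectation K (indicator A) x \<partial>Q)"
      unfolding kernel_expectation_def
      by (intro Bochner_Integration.integral_cong refl) (simp add: space_Q space_K sets.Int_space_eq2[OF A])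
    also have "\<dots> = (\<integral>x. indicator A x \<partial>Q)"
      by (rule integral_kernel_expectation[where c=1]) (auto simp: indicator_def)
    also have "\<dots> = measure Q A"
      using A sets_Q sets.sets_into_space[of A Q] by (simp add: Int_absorb2)
    finally show "emeasure (Q \<bind> K) A = emeasure Q A"
      by (simp add: emeasure_eq_measure QK.emeasure_eq_measure)
  qed
qed

text \<open>The geometric bound eventually falls below 1/4, so an admissible time exists and
  \<open>LEAST\<close> attains the minimum.\<close>

lemma mixing_time_props:
  shows mixing_time_ge_1: "1 \<le> mixing_time S K Q"
    and tv_dist_mixing_time: "x \<in> space S \<Longrightarrow> tv_dist (kernel_pow S K (mixing_time S K Q) x) Q \<le> 1 / 4"
proof -
  obtain C \<rho> where C: "0 < C" "0 < \<rho>" "\<rho> < 1"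
    "\<And>t. (SUP x\<in>space S. tv_dist (kernel_pow S K t x) Q) \<le> C * \<rho> ^ t"
    using ergodic unfolding uniformly_ergodic_def by blast
  have "(\<lambda>t. C * \<rho> ^ t) \<longlonglongrightarrow> C * 0"
    using C by (intro tendsto_intros LIMSEQ_power_zero) auto
  then have "\<forall>\<^sub>F t in sequentially. C * \<rho> ^ t < 1 / 4"
    by (rule order_tendstoD) simp
  then obtain t where "1 \<le> t" "C * \<rho> ^ t < 1 / 4"
    using eventually_happens'[OF sequentially_bot eventually_conj[OF _ eventually_ge_at_top[of 1]]] by blast
  then have "1 \<le> t \<and> (SUP x\<in>space S. tv_dist (kernel_pow S K t x) Q) \<le> 1 / 4"
    using C(4)[of t] by simp
  then have *: "1 \<le> mixing_time S K Q \<and>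
      (SUP x\<in>space S. tv_dist (kernel_pow S K (mixing_time S K Q) x) Q) \<le> 1 / 4"
    unfolding mixing_time_def by (rule LeastI)
  then show "1 \<le> mixing_time S K Q" by simp
  show "tv_dist (kernel_pow S K (mixing_time S K Q) x) Q \<le> 1 / 4" if "x \<in> space S"
    using * tv_dist_kernel_pow_le[OF that, of "mixing_time S K Q"] by linarith
qed

text \<open>Total variation 1/4 times the factor \<open>2 * c\<close> gives \<open>c / 2\<close>,
  and centring removes the integral under \<open>Q\<close>.\<close>

lemma funpow_mixing_time:
  assumes F: "F \<in> borel_measurable S" "\<And>z. z \<in> space S \<Longrightarrow> \<bar>F z\<bar> \<le> c" and "(\<integral>z. F z \<partial>Q) = 0"
    and x: "x \<in> space S"
  shows "\<bar>(kernel_expectation K ^^ mixing_time S K Q) F x\<bar> \<le> c / 2"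
proof -
  let ?N = "kernel_pow S K (mixing_time S K Q) x"
  have c0: "0 \<le> c" using F(2)[OF x] by linarith
  have "\<bar>(\<integral>z. F z \<partial>?N) - (\<integral>z. F z \<partial>Q)\<bar> \<le> 2 * c * tv_dist ?N Q"
    using F sets_kernel_pow[OF x] space_kernel_pow[OF x]
    by (intro tv_dist_integral prob_space_kernel_pow x prob_space_axioms) (auto simp: sets_Q cong: measurable_cong_sets)
  also have "\<dots> \<le> 2 * c * (1 / 4)"
    using tv_dist_mixing_time[OF x] c0 by (intro mult_left_mono) auto
  finally show ?thesis
    using assms(3) integral_kernel_pow[OF x F] by simp
qed

lemma integral_funpow:
  assumes "F \<in> borel_measurable S" "\<And>z. z \<in> space S \<Longrightarrow> \<bar>F z\<bar> \<le> c"
  shows "(\<integral>z. (kernel_expectation K ^^ k) F z \<partial>Q) = (\<integral>z. F z \<partial>Q)"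
  using assms
  by (induction k) (auto simp: integral_kernel_expectation[where c=c] kernel_expectation_funpow_bound)

text \<open>The halving is iterated over full mixing periods, where invariance keeps the mean 0; the
  remaining \<open>k mod mixing_time S K Q\<close> steps do not increase the sup norm.\<close>

lemma funpow_decay:
  assumes F: "F \<in> borel_measurable S" "\<And>z. z \<in> space S \<Longrightarrow> \<bar>F z\<bar> \<le> 1" and Q0: "(\<integral>z. F z \<partial>Q) = 0"
    and x: "x \<in> space S"
  shows "\<bar>(kernel_expectation K ^^ k) F x\<bar> \<le> (1 / 2) ^ (k div mixing_time S K Q)"
proof -
  let ?t = "mixing_time S K Q"
  have *: "\<bar>(kernel_expectation K ^^ (?t * j)) F x\<bar> \<le> (1 / 2) ^ j" if "x \<in> space S" for j x
    using that
  proof (induction j arbitrary: x)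
    case 0
    then show ?case using F by simp
  next
    case (Suc j)
    have "\<bar>(kernel_expectation K ^^ ?t) ((kernel_expectation K ^^ (?t * j)) F) x\<bar> \<le> (1 / 2) ^ j / 2"
      using F Suc integral_funpow[OF F, of "?t * j"] Q0 by (intro funpow_mixing_time) auto
    then show ?case
      by (simp add: funpow_add)
  qed
  have "(kernel_expectation K ^^ k) F x = (kernel_expectation K ^^ (k mod ?t + ?t * (k div ?t))) F x"
    by simp
  also have "\<dots> = (kernel_expectation K ^^ (k mod ?t)) ((kernel_expectation K ^^ (?t * (k div ?t))) F) x"
    unfolding funpow_add by simp
  also have "\<bar>\<dots>\<bar> \<le> (1 / 2) ^ (k div ?t)"
    using F x by (intro kernel_expectation_funpow_bound *) auto
  finally show ?thesis .
qed

text \<open>The solution is the series of all iterates of \<open>F\<close>; applying the kernel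
  shifts the series by one and so drops \<open>F\<close>. It converges uniformly by the blockwise
  decay.\<close>

lemma Poisson_equation:
  assumes F: "F \<in> borel_measurable S" "\<And>z. z \<in> space S \<Longrightarrow> \<bar>F z\<bar> \<le> 1" and Q0: "(\<integral>z. F z \<partial>Q) = 0"
  obtains h where "h \<in> borel_measurable S" "\<And>x. x \<in> space S \<Longrightarrow> \<bar>h x\<bar> \<le> 2 * real (mixing_time S K Q)"
    "\<And>x. x \<in> space S \<Longrightarrow> kernel_expectation K h x = h x - F x"
proof -
  let ?t = "mixing_time S K Q"
  let ?d = "\<lambda>k. (1 / 2 :: real) ^ (k div ?t)"
  let ?u = "\<lambda>k. (kernel_expectation K ^^ k) F"
  have sd: "summable ?d"
    using sum_half_div_le[OF mixing_time_ge_1] by (intro summableI_nonneg_bounded) auto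
  have d_le: "suminf ?d \<le> 2 * real ?t"
    using sum_half_div_le[OF mixing_time_ge_1] by (intro suminf_le_const sd)
  have dec: "\<bar>?u k x\<bar> \<le> ?d k" if "x \<in> space S" for k x
    using that F by (intro funpow_decay Q0) auto
  have su: "summable (\<lambda>k. \<bar>?u k x\<bar>)" if "x \<in> space S" for x
    using dec[OF that] by (intro summable_comparison_test'[OF sd]) auto
  define h where "h x = (\<Sum>k. ?u k x)" for x
  have hm[measurable]: "h \<in> borel_measurable S"
    unfolding h_def[abs_def] using F by measurable
  have hb: "\<bar>h x\<bar> \<le> 2 * real ?t" if x: "x \<in> space S" for x
  proof -
    have "\<bar>h x\<bar> \<le> (\<Sum>k. \<bar>?u k x\<bar>)"
      unfolding h_def by (rule summable_rabs[OF su[OF x]])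
    also have "\<dots> \<le> suminf ?d"
      by (intro suminf_le dec x su sd)
    finally show ?thesis using d_le by linarith
  qed
  have "kernel_expectation K h x = h x - F x" if x: "x \<in> space S" for x
  proof -
    interpret Kx: prob_space "K x" by (rule prob_space_K[OF x])
    have int: "integrable (K x) (?u k)" for k
      using F by (intro integrable_K[where c=1] x kernel_expectation_funpow_bound) auto
    have "kernel_expectation K h x = (\<Sum>k. \<integral>z. ?u k z \<partial>K x)"
      unfolding h_def[abs_def] kernel_expectation_def[of K _ x]
    proof (rule integral_suminf[OF int])
      show "AE z in K x. summable (\<lambda>k. norm (?u k z))"
        using su space_K[OF x] by (intro AE_I2) auto
      have "(\<integral>z. norm (?u k z) \<partial>K x) \<le> (\<integral>z. ?d k \<partial>K x)" for k
        using int dec space_K[OF x] by (intro integral_mono) auto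
      then show "summable (\<lambda>k. \<integral>z. norm (?u k z) \<partial>K x)"
        by (intro summable_comparison_test'[OF sd]) (auto simp: Kx.prob_space)
    qed
    also have "\<dots> = (\<Sum>k. ?u (Suc k) x)"
      by (simp add: kernel_expectation_def)
    also have "\<dots> = h x - F x"
      using suminf_split_head[OF summable_rabs_cancel[OF su[OF x]]] by (simp add: h_def)
    finally show ?thesis .
  qed
  with hm hb show ?thesis by (rule that)
qed

end

section \<open>Exponential supermartingales along the chain\<close>

text \<open>The step of the recursion for \<open>conditional_law\<close> is a kernel;
  \<open>1 \<le> n\<close> guarantees that the last index \<open>n + m\<close> is a coordinate even
  for \<open>m = 0\<close>.\<close>

lemma measurable_path_extension:
  fixes S :: "'a measure"
  assumes K[measurable]: "K \<in> S \<rightarrow>\<^sub>M prob_algebra S" and n: "1 \<le> n"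
  shows "(\<lambda>z. distr (K (z (n + m))) (\<Pi>\<^sub>M t\<in>{1..n + Suc m}. S) (\<lambda>u. z(n + Suc m := u)))
    \<in> (\<Pi>\<^sub>M t\<in>{1..n + m}. S) \<rightarrow>\<^sub>M prob_algebra (\<Pi>\<^sub>M t\<in>{1..n + Suc m}. S)"
proof (rule measurable_distr_prob_space2)
  have "(\<lambda>z. z (n + m)) \<in> (\<Pi>\<^sub>M t\<in>{1..n + m}. S) \<rightarrow>\<^sub>M S"
    using n by (intro measurable_component_singleton) auto
  then show "(\<lambda>z. K (z (n + m))) \<in> (\<Pi>\<^sub>M t\<in>{1..n + m}. S) \<rightarrow>\<^sub>M prob_algebra S"
    by measurable
  have "(\<lambda>v. (fst v)(n + Suc m := snd v)) \<in>
      (\<Pi>\<^sub>M t\<in>{1..n + m}. S) \<Otimes>\<^sub>M S \<rightarrow>\<^sub>M (\<Pi>\<^sub>M t\<in>{1..n + Suc m}. S)"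
    by (rule measurable_fun_upd[where J="{1..n + m}"]) auto
  then show "(\<lambda>(z, u). z(n + Suc m := u)) \<in>
      (\<Pi>\<^sub>M t\<in>{1..n + m}. S) \<Otimes>\<^sub>M S \<rightarrow>\<^sub>M (\<Pi>\<^sub>M t\<in>{1..n + Suc m}. S)"
    by (simp add: case_prod_beta)
qed

lemma conditional_law_in_prob_algebra:
  fixes S :: "'a measure"
  assumes K: "K \<in> S \<rightarrow>\<^sub>M prob_algebra S" and n: "1 \<le> n" and x: "\<And>t. x t \<in> space S"
  shows "conditional_law S K n x m \<in> space (prob_algebra (\<Pi>\<^sub>M t\<in>{1..n + m}. S))"
proof (induction m)
  case 0
  have "(\<lambda>t\<in>{1..n}. x t) \<in> space (\<Pi>\<^sub>M t\<in>{1..n}. S)"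
    using x by (auto simp: space_PiM)
  from measurable_space[OF measurable_return_prob_space this] show ?case by simp
next
  case (Suc m)
  show ?case
    using prob_space_bind'[OF Suc measurable_path_extension[OF K n]]
      sets_bind'[OF Suc measurable_path_extension[OF K n]]
    by (simp add: space_prob_algebra)
qed

text \<open>The supermartingale property in integrated form. The factor
  \<open>exp (- \<phi> (z (n + m)))\<close> cancels the newest summand, so that after one transition
  only \<open>V\<close> of the new state is left to average and the drift applies.\<close>

lemma nn_integral_conditional_law_le:
  fixes S :: "'a measure" and V :: "'a \<Rightarrow> ennreal" and \<phi> :: "'a \<Rightarrow> real"
  assumes K: "K \<in> S \<rightarrow>\<^sub>M prob_algebra S" and n: "1 \<le> n" and x: "\<And>t. x t \<in> space S"
    and V[measurable]: "V \<in> borel_measurable S" and phi[measurable]: "\<phi> \<in> borel_measurable S"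
    and drift: "\<And>x. x \<in> space S \<Longrightarrow> (\<integral>\<^sup>+u. V u \<partial>K x) \<le> ennreal (exp (- \<phi> x)) * V x"
  shows "(\<integral>\<^sup>+z. ennreal (exp (\<Sum>j=n+1..n+m. \<phi> (z j))) * (ennreal (exp (- \<phi> (z (n + m)))) * V (z (n + m)))
      \<partial>conditional_law S K n x m) \<le> ennreal (exp (- \<phi> (x n))) * V (x n)"
proof (induction m)
  case 0
  have xs: "(\<lambda>t\<in>{1..n}. x t) \<in> space (\<Pi>\<^sub>M t\<in>{1..n}. S)"
    using x by (auto simp: space_PiM)
  have [measurable]: "(\<lambda>z. z n) \<in> (\<Pi>\<^sub>M t\<in>{1..n}. S) \<rightarrow>\<^sub>M S"
    using n by (intro measurable_component_singleton) auto
  have "(\<integral>\<^sup>+z. ennreal (exp (- \<phi> (z n))) * V (z n) \<partial>return (\<Pi>\<^sub>M t\<in>{1..n}. S) (\<lambda>t\<in>{1..n}. x t)) =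
      ennreal (exp (- \<phi> (x n))) * V (x n)"
    using n by (subst nn_integral_return[OF xs]) auto
  then show ?case by simp
next
  case (Suc m)
  let ?N = "conditional_law S K n x m" and ?P = "\<lambda>m. \<Pi>\<^sub>M t\<in>{1..n + m}. S"
  let ?step = "\<lambda>z. distr (K (z (n + m))) (?P (Suc m)) (\<lambda>u. z(n + Suc m := u))"
  let ?G = "\<lambda>m z. ennreal (exp (\<Sum>j=n+1..n+m. \<phi> (z j))) * (ennreal (exp (- \<phi> (z (n + m)))) * V (z (n + m)))"
  have comp[measurable]: "(\<lambda>z. z j) \<in> ?P m \<rightarrow>\<^sub>M S" if "j \<in> {n..n + m}" for j m
    using n that by (intro measurable_component_singleton) auto
  have G[measurable]: "?G m \<in> borel_measurable (?P m)" for m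
  proof -
    have "(\<lambda>z. \<Sum>j=n+1..n+m. \<phi> (z j)) \<in> borel_measurable (?P m)"
      by (intro borel_measurable_sum measurable_compose[OF comp phi]) auto
    moreover have "(\<lambda>z. z (n + m)) \<in> ?P m \<rightarrow>\<^sub>M S"
      by (rule comp) simp
    ultimately show ?thesis by measurable
  qed
  have N: "?N \<in> space (prob_algebra (?P m))"
    by (rule conditional_law_in_prob_algebra[OF K n x])
  then have setsN: "sets ?N = sets (?P m)"
    by (simp add: space_prob_algebra)
  have step: "?step \<in> ?N \<rightarrow>\<^sub>M subprob_algebra (?P (Suc m))"
    using measurable_prob_algebraD[OF measurable_path_extension[OF K n]] setsN measurable_cong_sets by blast
  have "(\<integral>\<^sup>+z. ?G (Suc m) z \<partial>conditional_law S K n x (Suc m)) = (\<integral>\<^sup>+z. \<integral>\<^sup>+w. ?G (Suc m) w \<partial>?step z \<partial>?N)"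
    unfolding conditional_law.simps by (rule nn_integral_bind[OF G step])
  also have "\<dots> \<le> (\<integral>\<^sup>+z. ?G m z \<partial>?N)"
  proof (rule nn_integral_mono)
    fix z assume "z \<in> space ?N"
    then have z: "z \<in> space (?P m)"
      using sets_eq_imp_space_eq[OF setsN] by simp
    have zS: "z (n + m) \<in> space S"
      using measurable_space[OF comp z, of "n + m"] by simp
    have KS: "sets (K (z (n + m))) = sets S"
      using measurable_space[OF K zS] by (simp add: space_prob_algebra)
    have upd: "(\<lambda>u. z(n + Suc m := u)) \<in> K (z (n + m)) \<rightarrow>\<^sub>M ?P (Suc m)"
    proof -
      have "(\<lambda>u. z(n + Suc m := u)) \<in> S \<rightarrow>\<^sub>M ?P (Suc m)"
        using z by (intro measurable_fun_upd[where J="{1..n + m}"]) auto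
      then show ?thesis
        using KS measurable_cong_sets by blast
    qed
    have "(\<integral>\<^sup>+w. ?G (Suc m) w \<partial>?step z) = (\<integral>\<^sup>+u. ?G (Suc m) (z(n + Suc m := u)) \<partial>K (z (n + m)))"
      by (rule nn_integral_distr[OF upd], unfold measurable_distr_eq1, rule G)
    also have "\<dots> = (\<integral>\<^sup>+u. ennreal (exp (\<Sum>j=n+1..n+m. \<phi> (z j))) * V u \<partial>K (z (n + m)))"
    proof (rule nn_integral_cong)
      fix u
      have sum: "(\<Sum>j=n+1..n+Suc m. \<phi> ((z(n + Suc m := u)) j)) = (\<Sum>j=n+1..n+m. \<phi> (z j)) + \<phi> u"
        by (simp add: sum.cl_ivl_Suc)
      have "ennreal (exp ((\<Sum>j=n+1..n+m. \<phi> (z j)) + \<phi> u)) * ennreal (exp (- \<phi> u)) =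
          ennreal (exp (\<Sum>j=n+1..n+m. \<phi> (z j)))"
        by (simp flip: ennreal_mult exp_add)
      then show "?G (Suc m) (z(n + Suc m := u)) = ennreal (exp (\<Sum>j=n+1..n+m. \<phi> (z j))) * V u"
        unfolding sum by (simp flip: mult.assoc)
    qed
    also have "\<dots> = ennreal (exp (\<Sum>j=n+1..n+m. \<phi> (z j))) * (\<integral>\<^sup>+u. V u \<partial>K (z (n + m)))"
      using V KS by (intro nn_integral_cmult) (simp cong: measurable_cong_sets)
    also have "\<dots> \<le> ?G m z"
      by (intro mult_left_mono drift zS) simp
    finally show "(\<integral>\<^sup>+w. ?G (Suc m) w \<partial>?step z) \<le> ?G m z" .
  qed
  also note Suc.IH
  finally show ?case .
qed

text \<open>Markov's inequality for the supermartingale with \<open>\<phi> = \<psi> - l\<close>. The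
  prefactor compares start and end of the path: \<open>c2 / c1\<close> for \<open>V\<close>, and
  \<open>exp \<theta>\<close> for the factors \<open>exp (- \<phi>)\<close>, as \<psi> varies by at
  most \<theta>.\<close>

lemma conditional_law_tail:
  fixes S :: "'a measure" and V \<psi> :: "'a \<Rightarrow> real"
  assumes K: "K \<in> S \<rightarrow>\<^sub>M prob_algebra S" and n: "1 \<le> n" and m: "1 \<le> m" and x: "\<And>t. x t \<in> space S"
    and V[measurable]: "V \<in> borel_measurable S" and psi[measurable]: "\<psi> \<in> borel_measurable S"
    and V_bounds: "\<And>u. u \<in> space S \<Longrightarrow> c1 \<le> V u \<and> V u \<le> c2" and c1: "0 < c1"
    and psi_bounds: "\<And>u. u \<in> space S \<Longrightarrow> lo \<le> \<psi> u \<and> \<psi> u \<le> lo + \<theta>"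
    and drift: "\<And>x. x \<in> space S \<Longrightarrow> (\<integral>u. V u \<partial>K x) \<le> exp (l - \<psi> x) * V x"
  shows "\<P>(z in conditional_law S K n x m. (\<Sum>j=n+1..n+m. \<psi> (z j)) > l * real m + b)
    \<le> c2 / c1 * exp \<theta> * exp (- b)"
proof -
  let ?N = "conditional_law S K n x m" and ?P = "\<Pi>\<^sub>M t\<in>{1..n + m}. S"
  let ?\<phi> = "\<lambda>u. \<psi> u - l"
  let ?G = "\<lambda>z. exp (\<Sum>j=n+1..n+m. ?\<phi> (z j)) * (exp (- ?\<phi> (z (n + m))) * V (z (n + m)))"
  have NP: "?N \<in> space (prob_algebra ?P)"
    by (rule conditional_law_in_prob_algebra[OF K n x])
  then have setsN: "sets ?N = sets ?P" and "prob_space ?N"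
    by (auto simp: space_prob_algebra)
  interpret N: prob_space ?N by fact
  have V0: "0 \<le> V u" if "u \<in> space S" for u
    using V_bounds[OF that] c1 by linarith
  have V0': "0 \<le> V (x n)" by (intro V0 x)
  have comp: "(\<lambda>z. z j) \<in> ?N \<rightarrow>\<^sub>M S" if "j \<in> {n+1..n + m}" for j
  proof -
    have "(\<lambda>z. z j) \<in> ?P \<rightarrow>\<^sub>M S"
      using that by (intro measurable_component_singleton) auto
    then show ?thesis using setsN measurable_cong_sets by blast
  qed
  have [measurable]: "(\<lambda>z. \<Sum>j=n+1..n+m. \<psi> (z j)) \<in> borel_measurable ?N"
    by (intro borel_measurable_sum measurable_compose[OF comp psi]) auto
  \<comment> \<open>\<open>1 \<le> m\<close> puts \<open>n + m\<close> among the indices covered by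
    \<open>comp\<close>.\<close>
  have last: "z (n + m) \<in> space S" if "z \<in> space ?N" for z
    using measurable_space[OF comp that, of "n + m"] m by simp
  have "(\<integral>\<^sup>+z. ennreal (?G z) \<partial>?N) =
      (\<integral>\<^sup>+z. ennreal (exp (\<Sum>j=n+1..n+m. ?\<phi> (z j))) * (ennreal (exp (- ?\<phi> (z (n + m)))) * ennreal (V (z (n + m)))) \<partial>?N)"
    using last V0 by (intro nn_integral_cong) (simp add: ennreal_mult'')
  also have "\<dots> \<le> ennreal (exp (- ?\<phi> (x n))) * ennreal (V (x n))"
  proof (rule nn_integral_conditional_law_le[OF K n x])
    fix u assume u: "u \<in> space S"
    have Ku: "prob_space (K u)" "sets (K u) = sets S"
      using measurable_space[OF K u] by (auto simp: space_prob_algebra)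
    then interpret Ku: prob_space "K u" by simp
    have spu: "space (K u) = space S"
      using Ku(2) by (rule sets_eq_imp_space_eq)
    have "integrable (K u) V"
      using V_bounds c1 V Ku(2) spu by (intro Ku.integrable_const_bound[where B=c2])
        (fastforce simp: cong: measurable_cong_sets)+
    then have "(\<integral>\<^sup>+v. ennreal (V v) \<partial>K u) = ennreal (\<integral>v. V v \<partial>K u)"
      using V0 spu by (intro nn_integral_eq_integral) auto
    also have "\<dots> \<le> ennreal (exp (- ?\<phi> u) * V u)"
      using drift[OF u] by (intro ennreal_leI) simp
    finally show "(\<integral>\<^sup>+v. ennreal (V v) \<partial>K u) \<le> ennreal (exp (- ?\<phi> u)) * ennreal (V u)"
      using V0[OF u] by (simp add: ennreal_mult'')
  qed measurable
  also have "\<dots> = ennreal (exp (- ?\<phi> (x n)) * V (x n))"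
    using V0' by (simp add: ennreal_mult'')
  also have "\<dots> \<le> ennreal (exp (l - lo) * c2)"
    using psi_bounds[OF x[of n]] V_bounds[OF x[of n]] V0' by (intro ennreal_leI mult_mono) auto
  finally have total: "(\<integral>\<^sup>+z. ennreal (?G z) \<partial>?N) \<le> ennreal (exp (l - lo) * c2)" .
  let ?A = "{z\<in>space ?N. (\<Sum>j=n+1..n+m. \<psi> (z j)) > l * real m + b}"
  \<comment> \<open>A lower bound for \<open>?G\<close> on the event: \<open>exp b\<close> for the
    sum, then the least values of the two factors at the last state.\<close>
  let ?c = "exp b * (exp (l - lo - \<theta>) * c1)"
  have A[measurable]: "?A \<in> sets ?N" by measurable
  have "ennreal ?c * emeasure ?N ?A = (\<integral>\<^sup>+z. ennreal ?c * indicator ?A z \<partial>?N)"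
    by (rule nn_integral_cmult_indicator[symmetric, OF A])
  also have "\<dots> \<le> (\<integral>\<^sup>+z. ennreal (?G z) \<partial>?N)"
  proof (rule nn_integral_mono)
    fix z assume z: "z \<in> space ?N"
    show "ennreal ?c * indicator ?A z \<le> ennreal (?G z)"
    proof (cases "z \<in> ?A")
      case True
      have "exp b \<le> exp (\<Sum>j=n+1..n+m. ?\<phi> (z j))"
        using True by (simp add: sum_subtractf mult.commute)
      moreover have "exp (l - lo - \<theta>) \<le> exp (- ?\<phi> (z (n + m)))" "c1 \<le> V (z (n + m))"
        using psi_bounds[OF last[OF z]] V_bounds[OF last[OF z]] by auto
      ultimately have "?c \<le> ?G z"
        using c1 by (intro mult_mono) auto
      with True show ?thesis by (simp add: ennreal_leI)
    qed simp
  qed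
  also note total
  finally have "ennreal (?c * measure ?N ?A) \<le> ennreal (exp (l - lo) * c2)"
    using c1 by (simp add: N.emeasure_eq_measure ennreal_mult'')
  moreover have "0 \<le> c2" using V_bounds[OF x[of n]] V0' by linarith
  ultimately have "?c * measure ?N ?A \<le> exp (l - lo) * c2"
    by (simp add: ennreal_le_iff)
  then have "measure ?N ?A \<le> exp (l - lo) * c2 / ?c"
    using c1 by (subst pos_le_divide_eq) (auto simp: mult.commute)
  also have "\<dots> = c2 / c1 * exp \<theta> * exp (- b)"
    using c1 by (simp add: exp_diff exp_minus exp_add field_simps)
  finally show ?thesis by simp
qed

text \<open>With the exponential replaced by its lower bound \<open>1 + v\<close>, right side minus
  left side is \<open>\<mu> * ((1 + a) * \<theta> * (1 + \<eta> * h) - \<eta>) + f * (\<eta> -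
  \<theta> * (1 + \<eta> * h))\<close>. The choice of \<eta> means
  \<open>\<eta> = \<theta> * (1 + \<eta> * H)\<close>, so the second term is nonnegative; the slack
  \<open>a\<close> pays for the first.\<close>

lemma drift_ineq_upper:
  fixes f h \<mu> a \<theta> H \<eta> :: real
  assumes "0 \<le> f" "0 \<le> \<mu>" "0 < a" "a < 1" "0 < \<theta>" "0 \<le> H" "\<bar>h\<bar> \<le> H" "\<theta> * H \<le> a / 4"
    and \<eta>: "\<eta> = \<theta> / (1 - \<theta> * H)"
  shows "\<eta> * H \<le> a / 3" and "1 + \<eta> * (h - (f - \<mu>)) \<le> exp ((1 + a) * \<theta> * \<mu> - \<theta> * f) * (1 + \<eta> * h)"
proof -
  have d: "0 < 1 - \<theta> * H" using assms by linarith
  then have eta0: "0 < \<eta>"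
    using assms by simp
  have eq: "\<eta> = \<theta> * (1 + \<eta> * H)"
    using d \<eta> by (simp add: field_simps)
  show q: "\<eta> * H \<le> a / 3"
  proof -
    have "\<eta> * H = \<theta> * H / (1 - \<theta> * H)" using \<eta> by simp
    \<comment> \<open>The denominator is at least 3/4 because
      \<open>\<theta> * H \<le> a / 4\<close> and \<open>a < 1\<close>.\<close>
    also have "\<dots> \<le> (a / 4) / (3 / 4)"
      using assms by (intro frac_le) auto
    finally show ?thesis by simp
  qed
  have hb: "- (\<eta> * H) \<le> \<eta> * h" "\<eta> * h \<le> \<eta> * H"
    using assms eta0 mult_left_mono[of h H \<eta>] mult_left_mono[of "- H" h \<eta>] by auto
  have "\<theta> * (1 + \<eta> * h) \<le> \<theta> * (1 + \<eta> * H)"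
    using hb \<open>0 < \<theta>\<close> by (intro mult_left_mono) auto
  then have f0: "0 \<le> f * (\<eta> - \<theta> * (1 + \<eta> * h))"
    using eq \<open>0 \<le> f\<close> by (intro mult_nonneg_nonneg) linarith+
  have "1 + \<eta> * H \<le> (1 + a) * (1 + \<eta> * h)"
  proof -
    \<comment> \<open>With \<open>q = \<eta> * H\<close>, the inequality
      \<open>1 + q \<le> (1 + a) * (1 - q)\<close> amounts to \<open>q * (2 + a) \<le> a\<close>,
      and \<open>q \<le> a / 3\<close> suffices as \<open>2 + a \<le> 3\<close>.\<close>
    have "\<eta> * H * (2 + a) \<le> a / 3 * 3"
      using q assms(3-6) eta0 by (intro mult_mono) auto
    then have "1 + \<eta> * H \<le> (1 + a) * (1 - \<eta> * H)"
      by (simp add: algebra_simps)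
    also have "\<dots> \<le> (1 + a) * (1 + \<eta> * h)"
      using hb assms(3-4) by (intro mult_left_mono) auto
    finally show ?thesis .
  qed
  then have "\<theta> * (1 + \<eta> * H) \<le> \<theta> * ((1 + a) * (1 + \<eta> * h))"
    using assms by (intro mult_left_mono) auto
  then have "\<eta> \<le> (1 + a) * \<theta> * (1 + \<eta> * h)"
    unfolding eq[symmetric] by (simp only: mult_ac)
  then have m0: "0 \<le> \<mu> * ((1 + a) * \<theta> * (1 + \<eta> * h) - \<eta>)"
    using \<open>0 \<le> \<mu>\<close> by (intro mult_nonneg_nonneg) linarith+
  have "1 + \<eta> * (h - (f - \<mu>)) \<le> (1 + ((1 + a) * \<theta> * \<mu> - \<theta> * f)) * (1 + \<eta> * h)"
    using f0 m0 by (simp add: algebra_simps)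
  also have "\<dots> \<le> exp ((1 + a) * \<theta> * \<mu> - \<theta> * f) * (1 + \<eta> * h)"
    using hb q assms(3-4) by (intro mult_right_mono exp_ge_add_one_self) linarith
  finally show "1 + \<eta> * (h - (f - \<mu>)) \<le> exp ((1 + a) * \<theta> * \<mu> - \<theta> * f) * (1 + \<eta> * h)" .
qed

text \<open>The mirror image with \<open>1 - \<eta> * h\<close>. Now
  \<open>\<eta> = \<theta> * (1 - \<eta> * H)\<close>, so \<eta> is at most
  \<open>\<theta> * (1 - \<eta> * h)\<close>, which gives the terms in \<open>f\<close> the right
  sign; the factor \<open>1 - a\<close> absorbs the terms in \<mu>.\<close>

lemma drift_ineq_lower:
  fixes f h \<mu> a \<theta> H \<eta> :: real
  assumes "0 \<le> f" "0 \<le> \<mu>" "0 < a" "a < 1" "0 < \<theta>" "0 \<le> H" "\<bar>h\<bar> \<le> H" "\<theta> * H \<le> a / 4"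
    and \<eta>: "\<eta> = \<theta> / (1 + \<theta> * H)"
  shows "\<eta> * H \<le> a / 3" and "1 - \<eta> * (h - (f - \<mu>)) \<le> exp (- (1 - a) * \<theta> * \<mu> + \<theta> * f) * (1 - \<eta> * h)"
proof -
  have tH: "0 \<le> \<theta> * H" using assms by simp
  then have eta0: "0 < \<eta>"
    using assms by (simp add: add_pos_nonneg)
  have eq: "\<eta> = \<theta> * (1 - \<eta> * H)"
    using tH \<eta> by (simp add: field_simps add_pos_nonneg)
  have "\<theta> * (1 - \<eta> * H) \<le> \<theta> * 1"
    using eta0 assms(5,6) by (intro mult_left_mono) auto
  then have "\<eta> \<le> \<theta>"
    using eq by simp
  then have "\<eta> * H \<le> \<theta> * H"
    using assms by (intro mult_right_mono) auto
  then have q4: "\<eta> * H \<le> a / 4" using assms by linarith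
  then show q: "\<eta> * H \<le> a / 3" using assms by linarith
  have hb: "- (\<eta> * H) \<le> \<eta> * h" "\<eta> * h \<le> \<eta> * H"
    using assms eta0 mult_left_mono[of h H \<eta>] mult_left_mono[of "- H" h \<eta>] by auto
  have "\<theta> * (1 - \<eta> * H) \<le> \<theta> * (1 - \<eta> * h)"
    using hb \<open>0 < \<theta>\<close> by (intro mult_left_mono) auto
  then have f0: "0 \<le> f * (\<theta> * (1 - \<eta> * h) - \<eta>)"
    using eq \<open>0 \<le> f\<close> by (intro mult_nonneg_nonneg) linarith+
  have "(1 - a) * (1 - \<eta> * h) \<le> 1 - \<eta> * H"
  proof -
    have "(1 - a) * (1 - \<eta> * h) \<le> (1 - a) * (1 + \<eta> * H)"
      using hb assms(3-4) by (intro mult_left_mono) auto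
    also have "\<dots> \<le> 1 - \<eta> * H"
    proof -
      \<comment> \<open>For \<open>q = \<eta> * H\<close> the claim amounts to
        \<open>q * (2 - a) \<le> a\<close>, which follows from \<open>q \<le> a / 4\<close>.\<close>
      have "\<eta> * H * (2 - a) \<le> a / 4 * 2"
        using q4 assms(3-6) eta0 by (intro mult_mono) auto
      then show ?thesis using assms(3) by (simp add: algebra_simps)
    qed
    finally show ?thesis .
  qed
  then have "\<theta> * ((1 - a) * (1 - \<eta> * h)) \<le> \<theta> * (1 - \<eta> * H)"
    using assms by (intro mult_left_mono) auto
  then have "(1 - a) * \<theta> * (1 - \<eta> * h) \<le> \<eta>"
    unfolding eq[symmetric] by (simp only: mult_ac)
  then have m0: "0 \<le> \<mu> * (\<eta> - (1 - a) * \<theta> * (1 - \<eta> * h))"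
    using \<open>0 \<le> \<mu>\<close> by (intro mult_nonneg_nonneg) linarith+
  have "1 - \<eta> * (h - (f - \<mu>)) \<le> (1 + (- (1 - a) * \<theta> * \<mu> + \<theta> * f)) * (1 - \<eta> * h)"
    using f0 m0 by (simp add: algebra_simps)
  also have "\<dots> \<le> exp (- (1 - a) * \<theta> * \<mu> + \<theta> * f) * (1 - \<eta> * h)"
    using hb q assms(3-4) by (intro mult_right_mono exp_ge_add_one_self) linarith
  finally show "1 - \<eta> * (h - (f - \<mu>)) \<le> exp (- (1 - a) * \<theta> * \<mu> + \<theta> * f) * (1 - \<eta> * h)" .
qed

text \<open>The value 3 is 2 times 3/2, from \<open>q \<le> 1 / 3\<close> and
  \<open>\<theta> \<le> 1 / 8\<close>. The prefactor \<open>1 + 2 * exp (ln 2 / t_mix)\<close> of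
  the final bound is at least 3.\<close>

lemma prefactor_le_3:
  fixes q \<theta> :: real
  assumes "0 \<le> q" "q \<le> 1 / 3" "0 \<le> \<theta>" "\<theta> \<le> 1 / 8"
  shows "(1 + q) / (1 - q) * exp \<theta> \<le> 3"
proof -
  have "(1 + q) / (1 - q) \<le> (4 / 3) / (2 / 3)"
    using assms by (intro frac_le) auto
  moreover have "exp \<theta> \<le> 1 + \<theta> + \<theta>\<^sup>2"
    using assms by (intro exp_bound) auto
  moreover have "\<theta>\<^sup>2 \<le> (1 / 8)\<^sup>2"
    using assms by (intro power_mono) auto
  ultimately have "(1 + q) / (1 - q) * exp \<theta> \<le> 2 * (3 / 2)"
    using assms by (intro mult_mono) (auto simp: power2_eq_square)
  then show ?thesis by simp
qed

section \<open>Concentration of sums of a bounded function along the chain\<close>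

context ergodic_kernel
begin

text \<open>The Poisson equation for the centred function turns the drift inequalities into the
  drift hypothesis of \<open>conditional_law_tail\<close>, which is applied to
  \<open>\<theta> * f\<close> and to \<open>- \<theta> * f\<close>.\<close>

lemma concentration:
  fixes f :: "'a \<Rightarrow> real" and a \<theta> \<epsilon> :: real
  defines "\<mu> \<equiv> \<integral>z. f z \<partial>Q"
  assumes n: "1 \<le> n" and m: "1 \<le> m" and x: "\<And>t. x t \<in> space S"
    and f[measurable]: "f \<in> borel_measurable S" and f01: "\<And>z. z \<in> space S \<Longrightarrow> 0 \<le> f z \<and> f z \<le> 1"
    and a: "0 < a" "a < 1" and th: "0 < \<theta>" and th_le: "8 * real (mixing_time S K Q) * \<theta> \<le> a"
  shows concentration_upper: "\<P>(z in conditional_law S K n x m.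
        (\<Sum>j=n+1..n+m. f (z j)) > (1 + a) * (\<mu> + \<epsilon>) * real m) \<le> 3 * exp (- (\<theta> * (1 + a) * \<epsilon> * real m))"
    and concentration_lower: "\<P>(z in conditional_law S K n x m.
        (\<Sum>j=n+1..n+m. f (z j)) < (1 - a) * (\<mu> - \<epsilon>) * real m) \<le> 3 * exp (- (\<theta> * (1 - a) * \<epsilon> * real m))"
proof -
  let ?t = "real (mixing_time S K Q)"
  have t1: "1 \<le> ?t" using mixing_time_ge_1 by simp
  have f': "f \<in> borel_measurable Q" using f sets_Q measurable_cong_sets by blast
  have int_f: "integrable Q f"
    using f01 f' space_Q by (intro integrable_const_bound[where B=1]) auto
  have mu: "0 \<le> \<mu>" "\<mu> \<le> 1"
  proof -
    show "0 \<le> \<mu>"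
      unfolding \<mu>_def using f01 space_Q by (intro integral_nonneg_AE AE_I2) auto
    have "\<mu> \<le> (\<integral>z. 1 \<partial>Q)"
      unfolding \<mu>_def using f01 space_Q int_f by (intro integral_mono) auto
    then show "\<mu> \<le> 1" by (simp add: prob_space)
  qed
  have "(\<lambda>z. f z - \<mu>) \<in> borel_measurable S" by measurable
  moreover have "\<bar>f z - \<mu>\<bar> \<le> 1" if "z \<in> space S" for z
    using f01[OF that] mu by auto
  moreover have "(\<integral>z. f z - \<mu> \<partial>Q) = 0"
    using int_f by (simp add: prob_space \<mu>_def)
  ultimately obtain h where h[measurable]: "h \<in> borel_measurable S"
    and hb: "\<And>x. x \<in> space S \<Longrightarrow> \<bar>h x\<bar> \<le> 2 * ?t"
    and Kh: "\<And>x. x \<in> space S \<Longrightarrow> kernel_expectation K h x = h x - (f x - \<mu>)"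
    by (rule Poisson_equation) (assumption, rule that)
  \<comment> \<open>Allowing any sign of \<open>c\<close> serves \<open>V = 1 + \<eta> * h\<close>
    and \<open>V = 1 - \<eta> * h\<close> alike.\<close>
  have KV: "(\<integral>u. 1 + c * h u \<partial>K u') = 1 + c * (h u' - (f u' - \<mu>))" if u': "u' \<in> space S" for c u'
  proof -
    interpret Ku: prob_space "K u'" by (rule prob_space_K[OF u'])
    show ?thesis
      using integrable_K[OF u' h hb] Kh[OF u'] by (simp add: Ku.prob_space kernel_expectation_def)
  qed
  \<comment> \<open>With \<open>H\<close> twice the mixing time, the hypothesis on \<theta> is
    exactly \<open>\<theta> * H \<le> a / 4\<close>; since the mixing time is at least 1, it also
    gives \<open>\<theta> \<le> 1 / 8\<close>.\<close>
  have H: "0 \<le> 2 * ?t" "\<theta> * (2 * ?t) \<le> a / 4" and th8: "\<theta> \<le> 1 / 8"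
  proof -
    have "8 * \<theta> * 1 \<le> 8 * \<theta> * ?t"
      using t1 th by (intro mult_left_mono) auto
    then show "\<theta> \<le> 1 / 8" using th_le a by (simp add: mult_ac)
  qed (use th_le in \<open>auto simp: mult_ac\<close>)
  have bound: "c2 / c1 * exp \<theta> * exp (- b) \<le> 3 * exp (- b)"
    if "c1 = 1 - q" "c2 = 1 + q" "0 \<le> q" "q \<le> a / 3" for q b c1 c2 :: real
    using prefactor_le_3[of q \<theta>] that a th th8 by (intro mult_right_mono) auto
  { define \<eta> where "\<eta> = \<theta> / (1 - \<theta> * (2 * ?t))"
    have e0: "0 < \<eta>" using H th a by (simp add: \<eta>_def)
    have drift: "\<eta> * (2 * ?t) \<le> a / 3"
      "1 + \<eta> * (h u - (f u - \<mu>)) \<le> exp ((1 + a) * \<theta> * \<mu> - \<theta> * f u) * (1 + \<eta> * h u)" if "u \<in> space S" for u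
      using drift_ineq_upper[OF _ mu(1) a th H(1) hb[OF that] H(2) \<eta>_def, of "f u"] f01[OF that] by auto
    have q: "\<eta> * (2 * ?t) \<le> a / 3" using drift(1)[OF x[of n]] .
    have eh: "- (\<eta> * (2 * ?t)) \<le> \<eta> * h u \<and> \<eta> * h u \<le> \<eta> * (2 * ?t)" if "u \<in> space S" for u
      using hb[OF that] e0 mult_left_mono[of "h u" "2 * ?t" \<eta>] mult_left_mono[of "- (2 * ?t)" "h u" \<eta>] by auto
    have "\<P>(z in conditional_law S K n x m.
        (\<Sum>j=n+1..n+m. \<theta> * f (z j)) > (1 + a) * \<theta> * \<mu> * real m + \<theta> * (1 + a) * \<epsilon> * real m)
      \<le> (1 + \<eta> * (2 * ?t)) / (1 - \<eta> * (2 * ?t)) * exp \<theta> * exp (- (\<theta> * (1 + a) * \<epsilon> * real m))"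
    proof (rule conditional_law_tail[OF K n m x, where V="\<lambda>u. 1 + \<eta> * h u" and lo=0])
      show "0 \<le> \<theta> * f u \<and> \<theta> * f u \<le> 0 + \<theta>" if "u \<in> space S" for u
        using f01[OF that] th by (simp add: mult_left_le)
      show "(\<integral>v. 1 + \<eta> * h v \<partial>K u) \<le> exp ((1 + a) * \<theta> * \<mu> - \<theta> * f u) * (1 + \<eta> * h u)" if "u \<in> space S" for u
        unfolding KV[OF that] by (rule drift(2)[OF that])
    qed (use eh q a in \<open>auto simp: add_increasing2 intro: le_less_trans\<close>)
    also have "\<dots> \<le> 3 * exp (- (\<theta> * (1 + a) * \<epsilon> * real m))"
      using e0 t1 q by (intro bound) auto
    finally have *: "\<P>(z in conditional_law S K n x m.
        (\<Sum>j=n+1..n+m. \<theta> * f (z j)) > (1 + a) * \<theta> * \<mu> * real m + \<theta> * (1 + a) * \<epsilon> * real m)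
      \<le> 3 * exp (- (\<theta> * (1 + a) * \<epsilon> * real m))" .
    have eq: "(1 + a) * \<theta> * \<mu> * real m + \<theta> * (1 + a) * \<epsilon> * real m = \<theta> * ((1 + a) * (\<mu> + \<epsilon>) * real m)"
      by (simp add: algebra_simps)
    show "\<P>(z in conditional_law S K n x m.
        (\<Sum>j=n+1..n+m. f (z j)) > (1 + a) * (\<mu> + \<epsilon>) * real m) \<le> 3 * exp (- (\<theta> * (1 + a) * \<epsilon> * real m))"
      using * unfolding eq sum_distrib_left[symmetric] mult_less_cancel_left_pos[OF th] . }
  { define \<eta> where "\<eta> = \<theta> / (1 + \<theta> * (2 * ?t))"
    have e0: "0 < \<eta>" using H th a by (simp add: \<eta>_def add_pos_nonneg)
    have drift: "\<eta> * (2 * ?t) \<le> a / 3"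
      "1 - \<eta> * (h u - (f u - \<mu>)) \<le> exp (- (1 - a) * \<theta> * \<mu> + \<theta> * f u) * (1 - \<eta> * h u)" if "u \<in> space S" for u
      using drift_ineq_lower[OF _ mu(1) a th H(1) hb[OF that] H(2) \<eta>_def, of "f u"] f01[OF that] by auto
    have q: "\<eta> * (2 * ?t) \<le> a / 3" using drift(1)[OF x[of n]] .
    have eh: "- (\<eta> * (2 * ?t)) \<le> \<eta> * h u \<and> \<eta> * h u \<le> \<eta> * (2 * ?t)" if "u \<in> space S" for u
      using hb[OF that] e0 mult_left_mono[of "h u" "2 * ?t" \<eta>] mult_left_mono[of "- (2 * ?t)" "h u" \<eta>] by auto
    have "\<P>(z in conditional_law S K n x m.
        (\<Sum>j=n+1..n+m. - \<theta> * f (z j)) > (- (1 - a) * \<theta> * \<mu>) * real m + \<theta> * (1 - a) * \<epsilon> * real m)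
      \<le> (1 + \<eta> * (2 * ?t)) / (1 - \<eta> * (2 * ?t)) * exp \<theta> * exp (- (\<theta> * (1 - a) * \<epsilon> * real m))"
    \<comment> \<open>The range of \<open>- \<theta> * f\<close> starts at \<open>- \<theta>\<close>
      and again has width \<theta>, so a prefactor of the same form results.\<close>
    proof (rule conditional_law_tail[OF K n m x, where V="\<lambda>u. 1 + (- \<eta>) * h u" and lo="- \<theta>"])
      show "- \<theta> \<le> - \<theta> * f u \<and> - \<theta> * f u \<le> - \<theta> + \<theta>" if "u \<in> space S" for u
        using f01[OF that] th by (simp add: mult_left_le)
      show "(\<integral>v. 1 + (- \<eta>) * h v \<partial>K u) \<le> exp (- (1 - a) * \<theta> * \<mu> - - \<theta> * f u) * (1 + (- \<eta>) * h u)" if "u \<in> space S" for u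
        unfolding KV[OF that] using drift(2)[OF that] by simp
      show "1 - \<eta> * (2 * ?t) \<le> 1 + (- \<eta>) * h u \<and> 1 + (- \<eta>) * h u \<le> 1 + \<eta> * (2 * ?t)" if "u \<in> space S" for u
        using eh[OF that] by simp
    qed (use q a in auto)
    also have "\<dots> \<le> 3 * exp (- (\<theta> * (1 - a) * \<epsilon> * real m))"
      using e0 t1 q by (intro bound) auto
    finally have *: "\<P>(z in conditional_law S K n x m.
        (\<Sum>j=n+1..n+m. - \<theta> * f (z j)) > (- (1 - a) * \<theta> * \<mu>) * real m + \<theta> * (1 - a) * \<epsilon> * real m)
      \<le> 3 * exp (- (\<theta> * (1 - a) * \<epsilon> * real m))" .
    \<comment> \<open>Dividing by \<open>- \<theta>\<close> reverses the inequality, which turns the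
      upper tail for \<open>- \<theta> * f\<close> into the lower tail for \<open>f\<close>.\<close>
    have neg: "- \<theta> < 0" using th by simp
    have eq: "(- (1 - a) * \<theta> * \<mu>) * real m + \<theta> * (1 - a) * \<epsilon> * real m = - \<theta> * ((1 - a) * (\<mu> - \<epsilon>) * real m)"
      by (simp add: algebra_simps)
    show "\<P>(z in conditional_law S K n x m.
        (\<Sum>j=n+1..n+m. f (z j)) < (1 - a) * (\<mu> - \<epsilon>) * real m) \<le> 3 * exp (- (\<theta> * (1 - a) * \<epsilon> * real m))"
      using * unfolding eq sum_distrib_left[symmetric] mult_less_cancel_left_neg[of "- \<theta>", OF neg] . }
qed

end

section \<open>The block chain, its prediction losses and the final bounds\<close>

lemma measurable_block_kernel:
  fixes P :: "(nat \<Rightarrow> 'y::topological_space) \<Rightarrow> 'y measure"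
  assumes P: "P \<in> (\<Pi>\<^sub>M i\<in>{..<k}. borel) \<rightarrow>\<^sub>M prob_algebra borel" and k: "k \<le> p"
  shows "block_kernel k p P \<in> block_space p \<rightarrow>\<^sub>M prob_algebra (block_space p)"
  unfolding block_kernel_def[abs_def]
proof (rule measurable_distr_prob_space2)
  have "(\<lambda>x. \<lambda>i\<in>{..<k}. x i) \<in> block_space p \<rightarrow>\<^sub>M (\<Pi>\<^sub>M i\<in>{..<k}. borel :: 'y measure)"
    using k by (intro measurable_restrict measurable_component_singleton) auto
  then show "(\<lambda>x. P (\<lambda>i\<in>{..<k}. x i)) \<in> block_space p \<rightarrow>\<^sub>M prob_algebra borel"
    by (rule measurable_compose[OF _ P])
  have "(\<lambda>v. \<lambda>i\<in>{..p}. if i = 0 then snd v else fst v (i - 1)) \<in>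
      block_space p \<Otimes>\<^sub>M (borel :: 'y measure) \<rightarrow>\<^sub>M block_space p"
  proof (rule measurable_restrict)
    fix i assume "i \<in> {..p}"
    then show "(\<lambda>v. if i = 0 then snd v else fst v (i - 1)) \<in>
        block_space p \<Otimes>\<^sub>M (borel :: 'y measure) \<rightarrow>\<^sub>M borel"
      by (cases "i = 0") (auto intro!: measurable_compose[OF measurable_fst] measurable_component_singleton)
  qed
  then show "(\<lambda>(x, u). \<lambda>i\<in>{..p}. if i = 0 then u else x (i - 1)) \<in>
      block_space p \<Otimes>\<^sub>M (borel :: 'y measure) \<rightarrow>\<^sub>M block_space p"
    by (simp add: case_prod_beta)
qed

lemma measurable_prediction_loss:
  fixes L :: "'y::topological_space \<Rightarrow> 'y \<Rightarrow> real"
  assumes L: "loss_function L" and g: "g \<in> prediction_functions p"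
  shows "prediction_loss p L g \<in> borel_measurable (block_space p)"
proof -
  have "(\<lambda>x. \<lambda>i\<in>{..<p}. x (i + 1)) \<in> block_space p \<rightarrow>\<^sub>M (\<Pi>\<^sub>M i\<in>{..<p}. borel :: 'y measure)"
    by (intro measurable_restrict measurable_component_singleton) auto
  then have "(\<lambda>x. g (\<lambda>i\<in>{..<p}. x (i + 1))) \<in> block_space p \<rightarrow>\<^sub>M borel"
    using g unfolding prediction_functions_def by (rule measurable_compose)
  moreover have "(\<lambda>x. x 0) \<in> block_space p \<rightarrow>\<^sub>M (borel :: 'y measure)"
    by (intro measurable_component_singleton) auto
  ultimately have "(\<lambda>x. (g (\<lambda>i\<in>{..<p}. x (i + 1)), x 0)) \<in> block_space p \<rightarrow>\<^sub>M borel \<Otimes>\<^sub>M borel"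
    by (rule measurable_Pair)
  moreover have "case_prod L \<in> borel_measurable (borel \<Otimes>\<^sub>M borel)"
    using L by (simp add: loss_function_def)
  ultimately have "(\<lambda>x. case_prod L (g (\<lambda>i\<in>{..<p}. x (i + 1)), x 0)) \<in> borel_measurable (block_space p)"
    by (rule measurable_compose)
  then show ?thesis
    by (simp add: prediction_loss_def[abs_def])
qed

theorem theorem4p1:
  fixes M :: "'w measure"
    and Y :: "int \<Rightarrow> 'w \<Rightarrow> 'y::polish_space"
    and P :: "(nat \<Rightarrow> 'y) \<Rightarrow> 'y measure"
    and k0 p n m :: nat
    and L L' :: "'y \<Rightarrow> 'y \<Rightarrow> real"
    and G :: "((nat \<Rightarrow> 'y) \<Rightarrow> 'y) set"
    and g :: "(nat \<Rightarrow> 'y) \<Rightarrow> 'y"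
    and y :: "int \<Rightarrow> 'y"
    and a \<epsilon> :: real
  defines "K \<equiv> block_kernel k0 p P"
    and "Q \<equiv> distr M (block_space p) (\<lambda>\<omega>. block p (\<lambda>s. Y s \<omega>) 0)"
    and "x \<equiv> \<lambda>t::nat. block p y (int t)"
  defines "t_mix \<equiv> real (mixing_time (block_space p) K Q)"
    and "\<gamma> \<equiv> pseudo_spectral_gap Q K"
    and "Prob \<equiv> conditional_law (block_space p) K n x m"
  assumes "prob_space M"
    and "k0 \<le> p"
    and "markov_chain_of_order M k0 P Y"
    and "stationary M Y"
    and "uniformly_ergodic (block_space p) K Q"
    and "loss_function L"
    and "loss_function L'"
    and "G \<subseteq> prediction_functions p"
    and "1 \<le> n" and "1 \<le> m"
    and "is_arg_min (\<lambda>h. \<Sum>t=1..n. prediction_loss p L' h (x t)) (\<lambda>h. h \<in> G) g"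
    and "0 < a" and "a < 1"
    and "0 \<le> \<epsilon>" and "\<epsilon> \<le> 1"
  shows "\<P>(z in Prob. 1 / (1 + a) * validation_loss p L n m g z - expected_loss p L Q g > \<epsilon>)
           \<le> (1 + 2 * exp (ln 2 / t_mix)) *
              exp (- (a * (1 + a) * real m * \<epsilon> / (4 * t_mix * (8 * (1 + 1 / \<gamma>) + 20))))
         \<and> \<P>(z in Prob. expected_loss p L Q g - 1 / (1 - a) * validation_loss p L n m g z > \<epsilon>)
           \<le> (1 + 2 * exp (ln 2 / t_mix)) *
              exp (- (a * (1 - a) * real m * \<epsilon> / (4 * t_mix * (8 * (1 + 1 / \<gamma>) + 20))))"
proof -
  let ?S = "block_space p :: (nat \<Rightarrow> 'y) measure" and ?f = "prediction_loss p L g"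
  interpret M: prob_space M by fact
  have Y: "Y t \<in> borel_measurable M" for t
    using assms(9) by (simp add: markov_chain_of_order_def)
  have Km: "K \<in> ?S \<rightarrow>\<^sub>M prob_algebra ?S"
    unfolding K_def using assms(8,9) by (intro measurable_block_kernel) (auto simp: markov_chain_of_order_def)
  have "(\<lambda>\<omega>. block p (\<lambda>s. Y s \<omega>) 0) \<in> M \<rightarrow>\<^sub>M ?S"
    unfolding block_def by (intro measurable_restrict Y)
  then have "prob_space Q"
    unfolding Q_def by (rule M.prob_space_distr)
  then interpret ergodic_kernel ?S K Q
    unfolding ergodic_kernel_def ergodic_kernel_axioms_def
    using Km assms(11) by (auto simp: Q_def)
  have x: "x t \<in> space ?S" for t
    by (auto simp: x_def block_def space_PiM)
  \<comment> \<open>A minimizer over \<open>G\<close> belongs to \<open>G\<close>, so its loss is a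
    fixed measurable function on the block space.\<close>
  have "g \<in> prediction_functions p"
    using assms(14,17) by (auto simp: is_arg_min_def)
  then have f: "?f \<in> borel_measurable ?S"
    using assms(12) by (intro measurable_prediction_loss)
  have f01: "0 \<le> ?f z \<and> ?f z \<le> 1" for z
    using assms(12) by (simp add: loss_function_def prediction_loss_def)
  define D where "D = 8 * (1 + 1 / \<gamma>) + 20"
  \<comment> \<open>Nonnegativity of \<gamma> gives the bound; for \<open>\<gamma> = 0\<close> the
    quotient \<open>1 / \<gamma>\<close> is 0 and \<open>D\<close> is exactly 28.\<close>
  have D: "28 \<le> D"
    using pseudo_spectral_gap_nonneg by (simp add: D_def \<gamma>_def)
  have t1: "1 \<le> t_mix"
    using mixing_time_ge_1 by (simp add: t_mix_def)
  \<comment> \<open>This value makes the exponents of the concentration bounds equal to the claimed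
    ones. It is admissible since \<open>8 * t_mix * \<theta> = 2 * a / D\<close>, which is at most
    \<open>a\<close>.\<close>
  define \<theta> where "\<theta> = a / (4 * t_mix * D)"
  have th: "0 < \<theta>" using assms(18) t1 D by (simp add: \<theta>_def)
  have "8 * t_mix * \<theta> = 2 * a / D"
    using t1 D by (simp add: \<theta>_def field_simps)
  also have "\<dots> \<le> a"
    using assms(18) D by (simp add: divide_le_eq)
  finally have th_le: "8 * real (mixing_time ?S K Q) * \<theta> \<le> a"
    by (simp add: t_mix_def)
  note conc = concentration[where n=n and m=m and x=x and f="?f" and a=a and \<theta>=\<theta> and \<epsilon>=\<epsilon>,
      OF assms(15,16) x f f01 assms(18,19) th th_le]
  have pre: "3 * exp r \<le> (1 + 2 * exp (ln 2 / t_mix)) * exp r" for r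
  proof -
    have "1 \<le> exp (ln 2 / t_mix)" using t1 by simp
    then show ?thesis by (intro mult_right_mono) auto
  qed
  have m0: "0 < real m" using assms(16) by simp
  have upper: "1 / (1 + a) * validation_loss p L n m g z - expected_loss p L Q g > \<epsilon> \<longleftrightarrow>
      (\<Sum>j=n+1..n+m. ?f (z j)) > (1 + a) * ((\<integral>z. ?f z \<partial>Q) + \<epsilon>) * real m" for z
  proof -
    have "0 < (1 + a) * real m" using m0 assms(18) by simp
    from pos_less_divide_eq[OF this, of "(\<integral>z. ?f z \<partial>Q) + \<epsilon>" "\<Sum>j=n+1..n+m. ?f (z j)"] show ?thesis
      by (simp add: validation_loss_def expected_loss_def less_diff_eq add.commute mult_ac)
  qed
  have lower: "expected_loss p L Q g - 1 / (1 - a) * validation_loss p L n m g z > \<epsilon> \<longleftrightarrow>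
      (\<Sum>j=n+1..n+m. ?f (z j)) < (1 - a) * ((\<integral>z. ?f z \<partial>Q) - \<epsilon>) * real m" for z
  proof -
    have "0 < (1 - a) * real m" using m0 assms(19) by simp
    from pos_divide_less_eq[OF this, of "\<Sum>j=n+1..n+m. ?f (z j)" "(\<integral>z. ?f z \<partial>Q) - \<epsilon>"] show ?thesis
      by (simp add: validation_loss_def expected_loss_def less_diff_eq add.commute mult_ac)
  qed
  have exps: "\<theta> * (1 + a) * \<epsilon> * real m = a * (1 + a) * real m * \<epsilon> / (4 * t_mix * (8 * (1 + 1 / \<gamma>) + 20))"
    "\<theta> * (1 - a) * \<epsilon> * real m = a * (1 - a) * real m * \<epsilon> / (4 * t_mix * (8 * (1 + 1 / \<gamma>) + 20))"
    unfolding \<theta>_def D_def by (simp_all add: mult_ac)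
  show ?thesis
    unfolding upper lower Prob_def
    using order.trans[OF conc(1) pre] order.trans[OF conc(2) pre] unfolding exps by blast
qed

end
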